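(* Let $\eta^2=-3$, $\zeta=\frac{-1+\eta}{2}$, and let $X_\eta=\{a^4+a^2e_2(u_1,\dots,u_5)+e_4(u_1,\dots,u_5)=0\}$ in the hyperplane $L_\eta:\ u_1+\cdots+u_5=\eta a$ of $\mathbb{P}^5$, a model of the Burkhardt quartic. The hyperplanes of $L_\eta$ $$F_i:\ a+u_i=0,\qquad G_i:\ a-u_i=0\qquad(1\le i\le 5),$$ $$K_{pq}:\ u_p+u_q=0\quad(1\le p<q\le 5),\qquad S_{pq}:\ a-\zeta^2u_p+\zeta u_q=0\quad(p\neq q,\ 1\le p,q\le5)$$ are precisely the forty Steiner hyperplanes of the Burkhardt quartic $X_\eta$.
   Context: We work over $\mathbb{C}$; $e_r$ is the elementary symmetric polynomial of degree $r$, and $a,u_1,\dots,u_5$ are homogeneous coordinates on $\mathbb{P}^5$. The Burkhardt quartic is the quartic threefold $\{\sigma_1(x_0,\dots,x_5)=\sigma_4(x_0,\dots,x_5)=0\}\subset\mathbb{P}^5$ ($\sigma_r$ elementary symmetric polynomials in six variables), up to projective equivalence; it has exactly $45$ singular points, all nodes, and $X_\eta$ is projectively equivalent to it. A Steiner hyperplane of the Burkhardt quartic is a hyperplane (of the ambient $\mathbb{P}^4$, here $L_\eta$) containing exactly eighteen of its nodes; equivalently (classically), a hyperplane cutting the quartic in a union of four Jacobi planes, a Jacobi plane being a plane contained in the quartic and containing exactly nine nodes. Classically there are exactly forty Steiner hyperplanes. The forty-five nodes of $X_\eta$ are the following points $[a:u_1:\dots:u_5]$ of $L_\eta$. (i)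 For a partition $\{1,\dots,5\}=A\sqcup B\sqcup\{c\}$ with $|A|=|B|=2$, $R_{A,B;c}$ has $a=1$, $u_i=-1$ for $i\in A$, $u_j=1$ for $j\in B$, $u_c=\eta$. (ii) For $C=\{p,q\}\subset\{1,\dots,5\}$ with $p\ne q$, $T_C$ has $a=0$, $u_i=0$ for $i\notin C$, $u_p=1$, $u_q=-1$. (iii) For $c\in\{1,\dots,5\}$, $E_c$ has $a=1$, $u_c=-\eta/3$, $u_i=\eta/3$ for $i\neq c$. *)

theory Defs
  imports "HOL-Analysis.Analysis"
begin

text \<open>
  The homogeneous coordinates \<open>[a : u\<^sub>1 : \<dots> : u\<^sub>5]\<close> of \<open>\<P>\<^sup>5\<close> are the entries of a vector
  \<open>x :: complex ^ 6\<close>: the index type \<open>6\<close> is \<open>{0, 1, 2, 3, 4, 5}\<close>, with \<open>a = x $ 0\<close> and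
  \<open>u\<^sub>i = x $ i\<close> for \<open>i \<in> {1..5}\<close>. Linear subspaces of \<open>\<P>\<^sup>5\<close> are represented by their affine
  cones, that is, complex linear subspaces (\<open>vec.subspace\<close>) of \<open>complex ^ 6\<close>;
  in particular a point is a line through the origin.
\<close>

definition elem_sym :: "nat \<Rightarrow> 'i set \<Rightarrow> ('i \<Rightarrow> complex) \<Rightarrow> complex" where
  "elem_sym r A u = (\<Sum>I | I \<subseteq> A \<and> card I = r. \<Prod>i\<in>I. u i)"

definition dir_deriv :: "complex ^ 'n \<Rightarrow> (complex ^ 'n \<Rightarrow> complex) \<Rightarrow> complex ^ 'n \<Rightarrow> complex" where
  "dir_deriv v f x = deriv (\<lambda>t. f (x + t *s v)) 0"

text \<open>
  In the following, \<open>V\<close> is a linear subspace and \<open>f\<close> a form (homogeneous polynomial function),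
  and we consider the hypersurface \<open>f = 0\<close> in the projective space of \<open>V\<close>.
\<close>

definition singular_vector ::
    "(complex ^ 'n) set \<Rightarrow> (complex ^ 'n \<Rightarrow> complex) \<Rightarrow> complex ^ 'n \<Rightarrow> bool" where
  "singular_vector V f x \<longleftrightarrow>
     x \<in> V \<and> x \<noteq> 0 \<and> f x = 0 \<and> (\<forall>v\<in>V. dir_deriv v f x = 0)"

text \<open>
  A node is a singular point whose tangent cone is a nondegenerate quadric cone. The tangent
  space of the projective space of \<open>V\<close> at \<open>[x]\<close> is \<open>V\<close> modulo the line spanned by \<open>x\<close>, and the
  quadratic part of \<open>f\<close> at a singular \<open>x\<close> is the form induced there by the Hessian on \<open>V\<close>
  (by Euler's relation \<open>x\<close> lies in the radical of the Hessian). So nondegeneracy means that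
  the radical is no larger than that line.
\<close>

definition nodes ::
    "(complex ^ 'n) set \<Rightarrow> (complex ^ 'n \<Rightarrow> complex) \<Rightarrow> (complex ^ 'n) set set" where
  "nodes V f = {vec.span {x} | x. singular_vector V f x \<and>
     {w \<in> V. \<forall>v\<in>V. dir_deriv v (dir_deriv w f) x = 0} = vec.span {x}}"

definition hyperplane_of :: "(complex ^ 'n) set \<Rightarrow> (complex ^ 'n) set \<Rightarrow> bool" where
  "hyperplane_of V H \<longleftrightarrow> vec.subspace H \<and> H \<subseteq> V \<and> vec.dim H + 1 = vec.dim V"

definition steiner_hyperplane ::
    "(complex ^ 'n) set \<Rightarrow> (complex ^ 'n \<Rightarrow> complex) \<Rightarrow> (complex ^ 'n) set \<Rightarrow> bool" where
  "steiner_hyperplane V f H \<longleftrightarrow> hyperplane_of V H \<and> card {P \<in> nodes V f. P \<subseteq> H} = 18"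

definition L_space :: "complex \<Rightarrow> (complex ^ 6) set" where
  "L_space \<eta> = {x. (\<Sum>i\<in>{1..5}. x $ i) = \<eta> * x $ 0}"

text \<open>The quartic \<open>X\<^sub>\<eta>\<close> is the zero locus of this form in \<open>L_space \<eta>\<close>.\<close>

definition X_form :: "complex ^ 6 \<Rightarrow> complex" where
  "X_form x = (x $ 0) ^ 4 + (x $ 0)\<^sup>2 * elem_sym 2 {1..5} (($) x) + elem_sym 4 {1..5} (($) x)"

definition F_hyp :: "complex \<Rightarrow> 6 \<Rightarrow> (complex ^ 6) set" where
  "F_hyp \<eta> i = {x \<in> L_space \<eta>. x $ 0 + x $ i = 0}"

definition G_hyp :: "complex \<Rightarrow> 6 \<Rightarrow> (complex ^ 6) set" where
  "G_hyp \<eta> i = {x \<in> L_space \<eta>. x $ 0 - x $ i = 0}"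

definition K_hyp :: "complex \<Rightarrow> 6 \<Rightarrow> 6 \<Rightarrow> (complex ^ 6) set" where
  "K_hyp \<eta> p q = {x \<in> L_space \<eta>. x $ p + x $ q = 0}"

definition S_hyp :: "complex \<Rightarrow> complex \<Rightarrow> 6 \<Rightarrow> 6 \<Rightarrow> (complex ^ 6) set" where
  "S_hyp \<eta> \<zeta> p q = {x \<in> L_space \<eta>. x $ 0 - \<zeta>\<^sup>2 * x $ p + \<zeta> * x $ q = 0}"

end

theory Submission
  imports Defs
begin

text \<open>
  By the Lagrange condition, two coordinates of a singular point satisfy $u_i = u_j$ or
  $a^2 + e_2(u_k, u_l, u_m) = 0$, where $k, l, m$ are the remaining indices. Going through the seven
  possible patterns of equalities among $u_1, \ldots, u_5$ leaves exactly the forty-five points $R$,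
  $T$, $E$, and the linearised equations show that the Hessian is nondegenerate there.

  In the coordinates $y_i = u_i - \frac{\eta}{3} a$ on $L_\eta$ a hyperplane $\sum_i c_i y_i = 0$
  contains $E_p$ iff $c_p = 0$, $T_{\{p, q\}}$ iff $c_p = c_q$, and $R_{A,B;p}$ iff
  $c_p + \zeta \sum_A c_i + \zeta^2 \sum_B c_j = 0$. For fixed $p$ the last condition prescribes
  $\sum_A c_i$, which bounds the number of admissible $A$ in terms of the equalities among the
  coefficients. These bounds leave, up to permutation and scaling, only the coefficient vectors
  $(1,1,1,1,-\zeta)$, $(1,1,1,1,-\zeta^2)$, $(1,1,1,0,0)$ and $(0,0,0,-\zeta,1)$ with eighteen
  incident nodes, and these are the hyperplanes $F_i$, $G_i$, $K_{pq}$ and $S_{pq}$.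
\<close>

text \<open>\<open>nodes\<close> is defined by a vanishing gradient and a nondegenerate Hessian, so
  incidence counts mean nothing until the list of forty-five is known to be complete. L_\<eta> is
  not a coordinate hyperplane, and eliminating a variable would destroy the symmetry in the u_i;
  gradient and Hessian are therefore computed on all of \<open>complex ^ 6\<close> and restricted
  with a multiplier for u_1 + ... + u_5 - \<eta> a. The constant \<eta>/3 in y_i is dictated by the
  nodes E_c: their u_i with i \<noteq> c equal \<eta>/3, so they become the coordinate points. On
  L_\<eta> the y_i add up to -(2\<eta>/3) a, hence determine a and all u_i, and hyperplanes
  correspond to nonzero coefficient vectors up to scaling. Passing from A to another pair changes
  the condition for R by \<zeta> - \<zeta>^2 times the change of the sum over A, which is why
  \<zeta> \<noteq> \<zeta>^2 matters. Hyperplanes outside the four families contain at most sixteen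
  nodes, so crude bounds suffice to separate them from eighteen.\<close>

lemma UNIV_6: "(UNIV :: 6 set) = {0, 1, 2, 3, 4, 5}"
  by (rule card_eq_UNIV_imp_eq_UNIV[symmetric]) simp_all

text \<open>The order on the type \<open>6\<close> is the order of the representatives
  \<open>Rep\<close>, so membership in the interval is settled value by value.\<close>

lemma atLeastAtMost_1_5: "{1..5::6} = {1, 2, 3, 4, 5}"
proof -
  have "i \<in> {1..5} \<longleftrightarrow> i \<in> {1, 2, 3, 4, 5}" if "i \<in> {0, 1, 2, 3, 4, 5}" for i :: 6
    using that
    by (elim insertE emptyE) (simp_all add: less_eq_bit0_def bit0.Rep_numeral bit0.Rep_0 bit0.Rep_1)
  then show ?thesis unfolding UNIV_6[symmetric] by (intro set_eqI) simp
qed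

section \<open>Index sets and elementary symmetric polynomials\<close>

definition subsets_of_card :: "nat \<Rightarrow> 'a set \<Rightarrow> 'a set set" where
  "subsets_of_card r A = {C. C \<subseteq> A \<and> card C = r}"

text \<open>Pascal's rule: a subset of \<open>insert a A\<close> of size \<open>Suc r\<close> either
  avoids \<open>a\<close> or arises from a subset of \<open>A\<close> of size \<open>r\<close>. The
  same recursion serves the elementary symmetric polynomials and the counts over pairs of
  indices.\<close>

lemma sum_subsets_insert:
  fixes g :: "'a set \<Rightarrow> 'b::comm_monoid_add"
  assumes "finite A" "a \<notin> A"
  shows "sum g (subsets_of_card (Suc r) (insert a A)) =
    sum g (subsets_of_card (Suc r) A) + sum (\<lambda>C. g (insert a C)) (subsets_of_card r A)"
proof -
  have fin: "finite (subsets_of_card n A)" for n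
    using assms(1) by (simp add: subsets_of_card_def)
  have eq: "(subsets_of_card (Suc r) (insert a A)) =
    subsets_of_card (Suc r) A \<union> insert a ` (subsets_of_card r A)" (is "?L = ?R")
  proof (intro set_eqI iffI)
    fix C assume C: "C \<in> ?L"
    show "C \<in> ?R"
    proof (cases "a \<in> C")
      case True
      then have "C = insert a (C - {a})" "C - {a} \<in> subsets_of_card r A"
        using C by (auto simp: subsets_of_card_def)
      then show ?thesis by (intro UnI2 image_eqI)
    qed (use C in \<open>auto simp: subsets_of_card_def\<close>)
  next
    fix C assume "C \<in> ?R"
    then show "C \<in> ?L"
    proof
      assume "C \<in> insert a ` subsets_of_card r A"
      then obtain D where D: "C = insert a D" "D \<subseteq> A" "card D = r"
        by (auto simp: subsets_of_card_def)
      then have "finite D" "a \<notin> D"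
        using assms finite_subset by blast+
      with D show ?thesis by (auto simp: subsets_of_card_def)
    qed (auto simp: subsets_of_card_def)
  qed
  have notin: "a \<notin> C" if "C \<in> subsets_of_card n A" for C n
    using that assms(2) by (auto simp: subsets_of_card_def)
  have inj: "inj_on (insert a) (subsets_of_card r A)"
    by (intro inj_onI) (simp add: notin insert_ident)
  have disj: "subsets_of_card (Suc r) A \<inter> insert a ` subsets_of_card r A = {}"
    using notin[of _ "Suc r"] by blast
  show ?thesis
    unfolding eq using fin disj by (simp add: sum.union_disjoint sum.reindex[OF inj])
qed

lemma sum_subsets_0: "finite A \<Longrightarrow> sum g (subsets_of_card 0 A) = g {}"
proof -
  assume "finite A"
  then have "subsets_of_card 0 A = {{}}"
    by (auto simp: subsets_of_card_def dest: finite_subset)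
  then show ?thesis by simp
qed

lemma sum_subsets_empty: "sum g (subsets_of_card (Suc r) {}) = 0"
  by (rule sum.neutral) (auto simp: subsets_of_card_def)

text \<open>
  The coordinates $u_1, \ldots, u_5$ enter symmetrically. Arguments ``up to a permutation of the
  coordinates'' are phrased for an arbitrary ordering \<open>i, j, k, l, m\<close> of the indices.
\<close>

definition enumerates :: "6 \<Rightarrow> 6 \<Rightarrow> 6 \<Rightarrow> 6 \<Rightarrow> 6 \<Rightarrow> bool" where
  "enumerates i j k l m \<longleftrightarrow> distinct [i, j, k, l, m] \<and> {1..5} = {i, j, k, l, m}"

lemma finite_subsets_of_card: "finite A \<Longrightarrow> finite (subsets_of_card r A)"
  by (simp add: subsets_of_card_def)

lemma elem_sym_0: "finite A \<Longrightarrow> elem_sym 0 A u = 1"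
  using sum_subsets_0[of A "\<lambda>I. \<Prod>i\<in>I. u i"] by (simp add: elem_sym_def subsets_of_card_def)

lemma elem_sym_empty: "elem_sym (Suc r) {} u = 0"
  using sum_subsets_empty[of "\<lambda>I. \<Prod>i\<in>I. u i" r] by (simp add: elem_sym_def subsets_of_card_def)

lemma elem_sym_insert:
  assumes "finite A" "a \<notin> A"
  shows "elem_sym (Suc r) (insert a A) u = elem_sym (Suc r) A u + u a * elem_sym r A u"
proof -
  have "(\<Sum>C\<in>subsets_of_card r A. \<Prod>i\<in>insert a C. u i) = u a * elem_sym r A u"
    unfolding elem_sym_def subsets_of_card_def[symmetric] sum_distrib_left
  proof (intro sum.cong refl)
    fix C assume "C \<in> subsets_of_card r A"
    then have "C \<subseteq> A" by (simp add: subsets_of_card_def)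
    then have "finite C" "a \<notin> C"
      using assms finite_subset[of C A] by auto
    then show "(\<Prod>i\<in>insert a C. u i) = u a * (\<Prod>i\<in>C. u i)" by simp
  qed
  then show ?thesis
    using sum_subsets_insert[OF assms, of "\<lambda>I. \<Prod>i\<in>I. u i" r]
    by (simp add: elem_sym_def subsets_of_card_def)
qed

text \<open>\<open>numeral_eq_Suc\<close> turns numeral degrees into successors, so that the
  recursion expands \<open>elem_sym\<close> completely over an explicit index set.\<close>

lemmas elem_sym_simps = elem_sym_0 elem_sym_empty elem_sym_insert numeral_eq_Suc

text \<open>An elementary symmetric polynomial is affine in each variable; its derivative in one
  variable is the polynomial of the next lower degree in the others. \<open>r\<close> stays
  arbitrary in the induction because splitting off a variable lowers the degree.\<close>

lemma has_field_derivative_elem_sym: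
  assumes "finite A"
  shows "((\<lambda>t. elem_sym (Suc r) A (\<lambda>i. x i + t * v i)) has_field_derivative
    (\<Sum>i\<in>A. v i * elem_sym r (A - {i}) (\<lambda>i. x i + t * v i))) (at t)"
  using assms
proof (induction A arbitrary: r rule: finite_induct)
  case empty
  then show ?case by (simp add: elem_sym_empty)
next
  case (insert a A)
  have ne: "insert a A - {i} = insert a (A - {i})" if "i \<in> A" for i
    using that insert.hyps by auto
  show ?case
  proof (cases r)
    case 0
    show ?thesis
      using insert.hyps insert.IH[of 0] unfolding 0
      by (auto simp: elem_sym_insert elem_sym_0 ne intro!: derivative_eq_intros)
  next
    case (Suc r')
    have "(\<Sum>i\<in>insert a A. v i * elem_sym r (insert a A - {i}) u) =
       (\<Sum>i\<in>A. v i * elem_sym r (A - {i}) u) + (v a * elem_sym r A u +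
        u a * (\<Sum>i\<in>A. v i * elem_sym r' (A - {i}) u))" for u
      using insert.hyps
      by (simp add: ne elem_sym_insert Suc sum.distrib sum_distrib_left algebra_simps)
    then show ?thesis
      using insert.hyps insert.IH[of r] insert.IH[of r'] unfolding Suc
      by (auto simp: elem_sym_insert intro!: derivative_eq_intros)
  qed
qed

section \<open>Gradient and Hessian of the quartic\<close>

definition X_partial :: "complex ^ 6 \<Rightarrow> 6 \<Rightarrow> complex" where
  "X_partial x i = (if i = 0 then 4 * (x $ 0) ^ 3 + 2 * x $ 0 * elem_sym 2 {1..5} (($) x)
     else (x $ 0)\<^sup>2 * elem_sym 1 ({1..5} - {i}) (($) x) + elem_sym 3 ({1..5} - {i}) (($) x))"

text \<open>The entries with \<open>i = j \<noteq> 0\<close> vanish because the quartic has degree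
  at most one in each u_i.\<close>

definition X_hess :: "complex ^ 6 \<Rightarrow> 6 \<Rightarrow> 6 \<Rightarrow> complex" where
  "X_hess x i j =
    (if i = 0 \<and> j = 0 then 12 * (x $ 0)\<^sup>2 + 2 * elem_sym 2 {1..5} (($) x)
     else if i = 0 then 2 * x $ 0 * elem_sym 1 ({1..5} - {j}) (($) x)
     else if j = 0 then 2 * x $ 0 * elem_sym 1 ({1..5} - {i}) (($) x)
     else if i = j then 0
     else (x $ 0)\<^sup>2 + elem_sym 2 ({1..5} - {i, j}) (($) x))"

lemma UNIV_eq_insert_0: "(UNIV :: 6 set) = insert 0 {1..5}" 
  by (simp add: UNIV_6 atLeastAtMost_1_5)

lemma one_le_6 [simp]: "1 \<le> (i :: 6) \<longleftrightarrow> i \<noteq> 0"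
  and le_5 [simp]: "(i :: 6) \<le> 5"
proof -
  have "1 \<le> i \<longleftrightarrow> i \<noteq> 0" "i \<le> 5" if "i \<in> {0, 1, 2, 3, 4, 5}"
    using that
    by (elim insertE emptyE; simp add: less_eq_bit0_def bit0.Rep_numeral bit0.Rep_0 bit0.Rep_1)+
  then show "1 \<le> i \<longleftrightarrow> i \<noteq> 0" "i \<le> 5"
    using UNIV_6 by blast+
qed

lemma sum_UNIV_6: "sum g (UNIV :: 6 set) = g 0 + sum g {1..5}"
  unfolding UNIV_eq_insert_0 by (subst sum.insert) auto

lemma vec_nth_add_smult: "(($) (x + t *s v)) = (\<lambda>i. x $ i + t * v $ i)"
  by auto

lemma has_derivative_X_form:
  "((\<lambda>t. X_form (x + t *s v)) has_field_derivative
    (\<Sum>i\<in>UNIV. v $ i * X_partial (x + t *s v) i)) (at t)"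
proof -
  let ?E = "\<lambda>r t. elem_sym r {1..5} (($) (x + t *s v))"
  let ?D = "\<lambda>r. \<Sum>i\<in>{1..5}. v $ i * elem_sym r ({1..5} - {i}) (($) (x + t *s v))"
  let ?a = "x $ 0 + t * v $ 0"
  have d: "(?E (Suc r) has_field_derivative ?D r) (at t)" for r
    using has_field_derivative_elem_sym[of "{1..5}" r "($) x" "($) v" t]
    by (simp add: vec_nth_add_smult)
  have s: "(\<Sum>i\<in>UNIV. v $ i * X_partial (x + t *s v) i) =
     4 * ?a ^ 3 * v $ 0 + (2 * ?a * v $ 0 * ?E 2 t + ?a\<^sup>2 * ?D 1) + ?D 3"
    unfolding sum_UNIV_6 X_partial_def
    by (simp add: sum.distrib sum_distrib_left algebra_simps cong: sum.cong_simp)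
  \<comment> \<open>The product rule is proved for arbitrary \<open>f\<close> and \<open>g\<close>
    in place of the elementary symmetric terms, so that the derivative rules meet only opaque
    functions.\<close>
  have "((\<lambda>t. (a + t * b) ^ 4 + (a + t * b)\<^sup>2 * f t + g t) has_field_derivative
      4 * (a + t * b) ^ 3 * b + (2 * (a + t * b) * b * f t + (a + t * b)\<^sup>2 * f') + g') (at t)"
    if "(f has_field_derivative f') (at t)" "(g has_field_derivative g') (at t)"
    for a b f' g' and f g :: "complex \<Rightarrow> complex"
    using that by (auto intro!: derivative_eq_intros)
  from this[OF d[of 1] d[of 3], of "x $ 0" "v $ 0"] show ?thesis
    unfolding s X_form_def by (simp add: numeral_2_eq_2 eval_nat_numeral(2,3))
qed

lemma dir_deriv_X_form: "dir_deriv v X_form x = (\<Sum>i\<in>UNIV. v $ i * X_partial x i)"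
  unfolding dir_deriv_def using DERIV_imp_deriv[OF has_derivative_X_form[of x v 0]] by simp

lemma has_derivative_X_partial:
  "((\<lambda>t. X_partial (x + t *s v) i) has_field_derivative (\<Sum>j\<in>UNIV. v $ j * X_hess x j i)) (at 0)"
proof (cases "i = 0")
  case True
  have d: "((\<lambda>t. elem_sym 2 {1..5} (($) (x + t *s v))) has_field_derivative
    (\<Sum>i\<in>{1..5}. v $ i * elem_sym 1 ({1..5} - {i}) (($) x))) (at 0)"
    using has_field_derivative_elem_sym[of "{1..5}" 1 "($) x" "($) v" 0]
    by (simp add: numeral_2_eq_2 vec_nth_add_smult)
  have s: "(\<Sum>j\<in>UNIV. v $ j * X_hess x j i) = 
     v $ 0 * (12 * (x $ 0)\<^sup>2 + 2 * elem_sym 2 {1..5} (($) x)) +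
     2 * x $ 0 * (\<Sum>i\<in>{1..5}. v $ i * elem_sym 1 ({1..5} - {i}) (($) x))"
    unfolding sum_UNIV_6 X_hess_def True
    by (simp add: sum.distrib sum_distrib_left algebra_simps cong: sum.cong_simp)
  have "((\<lambda>t. 4 * (a + t * b) ^ 3 + 2 * (a + t * b) * f t) has_field_derivative
      b * (12 * a\<^sup>2 + 2 * f 0) + 2 * a * f') (at 0)"
    if "(f has_field_derivative f') (at 0)" for a b f' and f :: "complex \<Rightarrow> complex"
    using that by (auto intro!: derivative_eq_intros simp: algebra_simps)
  from this[OF d, of "x $ 0" "v $ 0"] show ?thesis
    unfolding s unfolding X_partial_def True by simp
next
  case False
  let ?A = "{1..5} - {i}"
  have d: "((\<lambda>t. elem_sym (Suc r) ?A (($) (x + t *s v))) has_field_derivative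
    (\<Sum>j\<in>?A. v $ j * elem_sym r (?A - {j}) (($) x))) (at 0)" for r
    using has_field_derivative_elem_sym[of ?A r "($) x" "($) v" 0]
    by (simp add: vec_nth_add_smult)
  have "i \<in> {1..5}" using False by simp
  \<comment> \<open>The diagonal entry is zero, so the sum over \<open>{1..5}\<close> shrinks to
    \<open>?A\<close>. The a^2 part of the other entries is the derivative of a^2 e_1, written with
    \<open>elem_sym 0\<close>, which equals 1.\<close>
  then have s: "(\<Sum>j\<in>UNIV. v $ j * X_hess x j i) = 
     v $ 0 * (2 * x $ 0 * elem_sym 1 ?A (($) x)) +
     ((x $ 0)\<^sup>2 * (\<Sum>j\<in>?A. v $ j * elem_sym 0 (?A - {j}) (($) x)) +
     (\<Sum>j\<in>?A. v $ j * elem_sym 2 (?A - {j}) (($) x)))"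
    unfolding sum_UNIV_6 X_hess_def using False
    by (simp add: sum.remove[of _ i] elem_sym_0 sum.distrib sum_distrib_left algebra_simps Diff_insert2[symmetric] insert_commute cong: sum.cong_simp)
  have "((\<lambda>t. (a + t * b)\<^sup>2 * f t + g t) has_field_derivative
      b * (2 * a * f 0) + (a\<^sup>2 * f' + g')) (at 0)"
    if "(f has_field_derivative f') (at 0)" "(g has_field_derivative g') (at 0)"
    for a b f' g' and f g :: "complex \<Rightarrow> complex"
    using that by (auto intro!: derivative_eq_intros simp: algebra_simps)
  from this[OF d[of 0] d[of 2], of "x $ 0" "v $ 0"] show ?thesis
    unfolding s X_partial_def using False by (simp add: numeral_2_eq_2 numeral_3_eq_3)
qed

lemma dir_deriv_dir_deriv_X_form:
  "dir_deriv v (dir_deriv w X_form) x = (\<Sum>j\<in>UNIV. v $ j * (\<Sum>i\<in>UNIV. w $ i * X_hess x j i))"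
proof -
  have "((\<lambda>t. dir_deriv w X_form (x + t *s v)) has_field_derivative
     (\<Sum>i\<in>UNIV. w $ i * (\<Sum>j\<in>UNIV. v $ j * X_hess x j i))) (at 0)"
    unfolding dir_deriv_X_form
    by (intro DERIV_sum DERIV_cmult has_derivative_X_partial)
  moreover have "(\<Sum>i\<in>UNIV. w $ i * (\<Sum>j\<in>UNIV. v $ j * X_hess x j i)) = 
     (\<Sum>j\<in>UNIV. v $ j * (\<Sum>i\<in>UNIV. w $ i * X_hess x j i))"
    unfolding sum_distrib_left by (subst sum.swap) (simp add: mult_ac)
  ultimately show ?thesis
    unfolding dir_deriv_def by (simp add: DERIV_imp_deriv)
qed

text \<open>The five vectors with a = 1, u_i = \<eta> and all other coordinates 0 span L_\<eta>, and
  the right-hand side expresses vanishing on them. This multiplier criterion is used for the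
  gradient and again for the Hessian applied to a vector.\<close>

lemma annihilates_L_space_iff:
  assumes "\<eta> \<noteq> 0"
  shows "(\<forall>v\<in>L_space \<eta>. (\<Sum>i\<in>UNIV. v $ i * g i) = 0) \<longleftrightarrow> (\<forall>i\<in>{1..5}. g 0 + \<eta> * g i = 0)"
proof
  assume *: "\<forall>v\<in>L_space \<eta>. (\<Sum>i\<in>UNIV. v $ i * g i) = 0"
  show "\<forall>i\<in>{1..5}. g 0 + \<eta> * g i = 0"
  proof
    fix i :: 6 assume i: "i \<in> {1..5}"
    define v :: "complex ^ 6" where "v = (\<chi> k. if k = 0 then 1 else if k = i then \<eta> else 0)"
    have "(\<Sum>k\<in>{1..5}. v $ k) = (\<Sum>k\<in>{1..5}. if k = i then \<eta> else 0)"
      by (intro sum.cong) (auto simp: v_def)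
    then have "v \<in> L_space \<eta>"
      using i by (simp add: L_space_def v_def)
    moreover have "(\<Sum>k\<in>{1..5}. v $ k * g k) = (\<Sum>k\<in>{1..5}. if k = i then \<eta> * g i else 0)"
      by (intro sum.cong) (auto simp: v_def)
    ultimately show "g 0 + \<eta> * g i = 0"
      using * i by (fastforce simp: sum_UNIV_6 v_def)
  qed
next
  assume *: "\<forall>i\<in>{1..5}. g 0 + \<eta> * g i = 0"
  then have g: "g i = - g 0 / \<eta>" if "i \<in> {1..5}" for i
    using that assms by (simp add: field_simps eq_neg_iff_add_eq_0)
  show "\<forall>v\<in>L_space \<eta>. (\<Sum>i\<in>UNIV. v $ i * g i) = 0"
  proof
    fix v assume "v \<in> L_space \<eta>"
    moreover have "(\<Sum>i\<in>{1..5}. v $ i * g i) = (\<Sum>i\<in>{1..5}. v $ i) * (- g 0 / \<eta>)"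
      unfolding sum_distrib_right by (intro sum.cong) (simp_all add: g)
    ultimately show "(\<Sum>i\<in>UNIV. v $ i * g i) = 0"
      using assms by (simp add: sum_UNIV_6 L_space_def)
  qed
qed

section \<open>Orderings of the five coordinates\<close>

text \<open>Adjacent transpositions generate all permutations, so every ordering needed later is
  reached by chaining these rules.\<close>

lemma enumerates_swap:
  assumes "enumerates i j k l m"
  shows "enumerates j i k l m" "enumerates i k j l m" "enumerates i j l k m" "enumerates i j k m l"
  using assms unfolding enumerates_def by (auto simp: insert_commute)

lemma card_5: "card {1..5::6} = 5"
  by (simp add: atLeastAtMost_1_5)

lemma enumeratesI:
  assumes "{i, j, k, l, m} = {1..5}"
  shows "enumerates i j k l m"
proof -
  have "card (set [i, j, k, l, m]) = length [i, j, k, l, m]"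
    using assms card_5 by simp
  then show ?thesis
    unfolding enumerates_def using assms card_distinct by blast
qed

text \<open>The cases are the seven partitions of 5, by the sizes of the fibres of \<open>c\<close>.
  A largest fibre fixes the case unless its size is 3 or 2; then the values outside it are compared.
  The lemma serves twice, for the coordinates of a singular point and for the coefficients of a
  hyperplane.\<close>

lemma pattern_cases:
  fixes c :: "6 \<Rightarrow> 'a"
  obtains (five) i j k l m where "enumerates i j k l m" "c j = c i" "c k = c i" "c l = c i" "c m = c i"
  | (four) i j k l m where "enumerates i j k l m" "c j = c i" "c k = c i" "c l = c i" "c i \<noteq> c m"
  | (three_two) i j k l m where "enumerates i j k l m" "c j = c i" "c k = c i" "c i \<noteq> c l" "c m = c l"
  | (three) i j k l m where "enumerates i j k l m" "c j = c i" "c k = c i" "distinct [c i, c l, c m]"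
  | (two_two) i j k l m where "enumerates i j k l m" "c j = c i" "c l = c k" "distinct [c i, c k, c m]"
  | (two) i j k l m where "enumerates i j k l m" "c j = c i" "distinct [c i, c k, c l, c m]"
  | (one) i j k l m where "enumerates i j k l m" "distinct [c i, c j, c k, c l, c m]"
proof -
  define F where "F x = {y \<in> {1..5}. c y = c x}" for x
  have fin: "finite (F x)" and sub: "F x \<subseteq> {1..5}" for x by (auto simp: F_def)
  let ?N = "(\<lambda>x. card (F x)) ` {1..5}"
  have "{1..5::6} \<noteq> {}" using card_5 by fastforce
  then have "Max ?N \<in> ?N"
    by (intro Max_in) auto
  then obtain z where z: "Max ?N = card (F z)" "z \<in> {1..5}"
    by (rule imageE)
  have max: "card (F x) \<le> card (F z)" if "x \<in> {1..5}" for x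
    unfolding z(1)[symmetric] using that by (intro Max_ge) auto
  define G where "G = {1..5} - F z"
  have FG: "F z \<union> G = {1..5}" and G: "finite G" using sub G_def by auto
  have G_ne: "c z \<noteq> c x" if "x \<in> G" for x
    using that unfolding G_def F_def by auto
  have F_eq: "c x = c z" if "x \<in> F z" for x
    using that unfolding F_def by blast
  have cardG: "card G = 5 - card (F z)"
    unfolding G_def using sub fin by (simp add: card_Diff_subset card_5)
  have "z \<in> F z" using z by (simp add: F_def)
  then have "card (F z) \<noteq> 0" using fin by auto
  moreover have "card (F z) \<le> 5" using card_mono[OF _ sub[of z]] card_5 by simp
  ultimately consider "card (F z) = 5" | "card (F z) = 4" | "card (F z) = 3" | "card (F z) = 2" | "card (F z) = 1"
    by linarith
  moreover obtain zs where zs: "set zs = F z" "length zs = card (F z)"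
    using finite_distinct_list[OF fin] distinct_card by metis
  ultimately show thesis
  proof cases
    case 1
    then have "length zs = 5" using zs by simp
    then obtain i j k l m where "zs = [i, j, k, l, m]"
      by (auto simp: length_Suc_conv numeral_eq_Suc)
    then have F: "F z = {i, j, k, l, m}" using zs(1) by auto
    moreover have "G = {}" using 1 cardG G by simp
    ultimately have "enumerates i j k l m" using FG by (intro enumeratesI) simp
    moreover have "c x = c i" if "x \<in> {i, j, k, l, m}" for x
      using that F_eq unfolding F by auto
    ultimately show thesis using that(1) by blast
  next
    case 2
    then have "length zs = 4" using zs by simp
    then obtain i j k l where "zs = [i, j, k, l]"
      by (auto simp: length_Suc_conv numeral_eq_Suc)
    then have F: "F z = {i, j, k, l}" using zs(1) by auto
    moreover have "card G = 1" using 2 cardG by simp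
    then obtain m where M: "G = {m}" by (auto simp: card_1_singleton_iff)
    ultimately have "enumerates i j k l m" using FG by (intro enumeratesI) auto
    moreover have "c x = c i" if "x \<in> {i, j, k, l}" for x
      using that F_eq unfolding F by auto
    moreover have "c i \<noteq> c m" using G_ne F_eq unfolding F M by auto
    ultimately show thesis using that(2) by blast
  next
    case 3
    then obtain i j k where F: "F z = {i, j, k}"
      by (auto simp: card_3_iff)
    moreover have "card G = 2" using 3 cardG by simp
    then obtain l m where M: "G = {l, m}" by (auto simp: card_2_iff)
    ultimately have *: "enumerates i j k l m" using FG by (intro enumeratesI) auto
    have **: "c x = c i" if "x \<in> {i, j, k}" for x
      using that F_eq unfolding F by auto
    have ***: "c i \<noteq> c x" if "x \<in> {l, m}" for x
      using that G_ne F_eq unfolding F M by auto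
    show thesis
    proof (cases "c m = c l")
      case True
      then show thesis using that(3)[OF *] ** *** by blast
    next
      case False
      then have "distinct [c i, c l, c m]" using ***[of l] ***[of m] by auto
      then show thesis using that(4)[OF *] ** by blast
    qed
  next
    case 4
    then obtain i j where F: "F z = {i, j}" 
      by (auto simp: card_2_iff)
    moreover have "card G = 3" using 4 cardG by simp
    then obtain k l m where M: "G = {k, l, m}" by (auto simp: card_3_iff)
    ultimately have *: "enumerates i j k l m" using FG by (intro enumeratesI) auto
    have cj: "c j = c i" using F_eq unfolding F by simp
    have ne: "c i \<noteq> c k" "c i \<noteq> c l" "c i \<noteq> c m"
      using G_ne F_eq unfolding F M by auto
    \<comment> \<open>Three equal values outside would form a fibre of size 3, larger than the
      chosen one.\<close>
    have not3: "\<not> (c k = c l \<and> c k = c m)"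
    proof
      assume "c k = c l \<and> c k = c m"
      then have "G \<subseteq> F k" using M FG unfolding F_def by auto
      then have "3 \<le> card (F k)" using card_mono[OF fin] \<open>card G = 3\<close> by metis
      moreover have "k \<in> {1..5}" using M FG by blast
      ultimately show False using max[of k] 4 by linarith
    qed
    consider "c k = c l" | "c k = c m" | "c l = c m" | "distinct [c k, c l, c m]" by auto
    then show thesis
    proof cases
      case 1
      then show thesis using that(5)[OF *] cj ne not3 by auto
    next
      case 2
      then show thesis using that(5)[OF enumerates_swap(4)[OF *]] cj ne not3 by auto
    next
      case 3
      then show thesis
        using that(5)[OF enumerates_swap(4)[OF enumerates_swap(3)[OF *]]] cj ne not3 by auto
    next
      case 4
      then show thesis using that(6)[OF * cj] ne by auto
    qed
  next
    case 5
    have inj: "c x \<noteq> c y" if "x \<in> {1..5}" "y \<in> {1..5}" "x \<noteq> y" for x y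
    proof
      assume "c x = c y"
      then have "{x, y} \<subseteq> F x" using that by (simp add: F_def)
      then have "card {x, y} \<le> card (F x)" using card_mono[OF fin] by blast
      with max[OF that(1)] 5 that(3) show False by simp
    qed
    have "enumerates 1 2 3 4 5" by (rule enumeratesI) (simp add: atLeastAtMost_1_5)
    then show thesis using that(7)[of 1 2 3 4 5] inj by simp
  qed
qed

lemma enumeratesD:
  assumes "enumerates i j k l m"
  shows "i \<noteq> 0" "j \<noteq> 0" "k \<noteq> 0" "l \<noteq> 0" "m \<noteq> 0" "distinct [i, j, k, l, m]"
    "{1..5} = {i, j, k, l, m}" "distinct [m, l, k, j, i]"
proof -
  have "0 \<notin> {i, j, k, l, m}"
    using assms unfolding enumerates_def by (metis atLeastAtMost_iff one_le_6)
  then show "i \<noteq> 0" "j \<noteq> 0" "k \<noteq> 0" "l \<noteq> 0" "m \<noteq> 0" by auto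
qed (use assms in \<open>auto simp: enumerates_def\<close>)

lemma sum_enumerates:
  assumes "enumerates i j k l m"
  shows "sum g {1..5} = g i + g j + g k + g l + g m"
  using enumeratesD(6,7)[OF assms] by (simp add: add.assoc)

lemma ball_enumerates:
  assumes "enumerates i j k l m"
  shows "(\<forall>x\<in>{1..5}. P x) \<longleftrightarrow> P i \<and> P j \<and> P k \<and> P l \<and> P m"
  using enumeratesD(7)[OF assms] by auto

lemma vec_eq_enumerates:
  fixes x y :: "'a ^ 6"
  assumes "enumerates i j k l m"
  shows "x = y \<longleftrightarrow> x $ 0 = y $ 0 \<and> x $ i = y $ i \<and> x $ j = y $ j \<and> x $ k = y $ k \<and> x $ l = y $ l \<and> x $ m = y $ m"
proof -
  have "x = y \<longleftrightarrow> (\<forall>n\<in>insert 0 {1..5}. x $ n = y $ n)"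
    unfolding vec_eq_iff UNIV_eq_insert_0[symmetric] by simp
  then show ?thesis using ball_enumerates[OF assms] by simp
qed

lemma enumerates_Diff:
  assumes "enumerates i j k l m"
  shows "{1..5} - {i} = {j, k, l, m}" "{1..5} - {i, j} = {k, l, m}"
proof -
  have "distinct [i, j, k, l, m]" "{1..5} = {i, j, k, l, m}"
    using assms by (auto simp: enumerates_def)
  then show "{1..5} - {i} = {j, k, l, m}" "{1..5} - {i, j} = {k, l, m}"
    unfolding \<open>{1..5} = {i, j, k, l, m}\<close> by auto
qed

text \<open>Only the entries for \<open>0\<close> and for the first index are expanded; any other
  index is moved to the front by reordering.\<close>

lemma X_partial_enumerates:
  assumes "enumerates i j k l m"
  shows "X_partial x 0 = 4 * (x$0)^3 + 2 * x$0 * (x$i*x$j + x$i*x$k + x$i*x$l + x$i*x$m + x$j*x$k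
      + x$j*x$l + x$j*x$m + x$k*x$l + x$k*x$m + x$l*x$m)"
    and "X_partial x i = (x$0)\<^sup>2 * (x$j + x$k + x$l + x$m)
      + (x$j*x$k*x$l + x$j*x$k*x$m + x$j*x$l*x$m + x$k*x$l*x$m)"
  using enumeratesD(1-6)[OF assms]
  by (simp_all add: X_partial_def enumerates_Diff[OF assms] enumeratesD(7)[OF assms] elem_sym_simps algebra_simps del: power_Suc)

lemma X_form_enumerates:
  assumes "enumerates i j k l m"
  shows "X_form x = (x$0)^4 + (x$0)\<^sup>2 * (x$i*x$j + x$i*x$k + x$i*x$l + x$i*x$m + x$j*x$k + x$j*x$l
      + x$j*x$m + x$k*x$l + x$k*x$m + x$l*x$m) + (x$i*x$j*x$k*x$l + x$i*x$j*x$k*x$m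
      + x$i*x$j*x$l*x$m + x$i*x$k*x$l*x$m + x$j*x$k*x$l*x$m)"
  using enumeratesD[OF assms]
  by (simp add: X_form_def elem_sym_simps algebra_simps del: power_Suc)

lemma X_hess_enumerates:
  assumes "enumerates i j k l m"
  shows "X_hess x 0 0 = 12 * (x$0)\<^sup>2 + 2 * (x$i*x$j + x$i*x$k + x$i*x$l + x$i*x$m + x$j*x$k
      + x$j*x$l + x$j*x$m + x$k*x$l + x$k*x$m + x$l*x$m)"
    and "X_hess x 0 i = 2 * x$0 * (x$j + x$k + x$l + x$m)"
    and "X_hess x i 0 = 2 * x$0 * (x$j + x$k + x$l + x$m)"
    and "X_hess x i i = 0"
    and "X_hess x i j = (x$0)\<^sup>2 + (x$k*x$l + x$k*x$m + x$l*x$m)"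
  using enumeratesD(1-6)[OF assms]
  by (simp_all add: X_hess_def enumerates_Diff[OF assms] enumeratesD(7)[OF assms] elem_sym_simps algebra_simps del: power_Suc)

lemma X_hess_row_enumerates:
  assumes "enumerates i j k l m"
  shows "(\<Sum>n\<in>UNIV. w $ n * X_hess x 0 n) =
      w$0 * (12 * (x$0)\<^sup>2 + 2 * (x$i*x$j + x$i*x$k + x$i*x$l + x$i*x$m + x$j*x$k
      + x$j*x$l + x$j*x$m + x$k*x$l + x$k*x$m + x$l*x$m))
      + 2 * x$0 * (w$i * (x$j + x$k + x$l + x$m) + w$j * (x$i + x$k + x$l + x$m)
      + w$k * (x$i + x$j + x$l + x$m) + w$l * (x$i + x$j + x$k + x$m) + w$m * (x$i + x$j + x$k + x$l))"
      (is ?row0)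
    and "(\<Sum>n\<in>UNIV. w $ n * X_hess x i n) =
      w$0 * (2 * x$0 * (x$j + x$k + x$l + x$m)) + w$j * ((x$0)\<^sup>2 + (x$k*x$l + x$k*x$m + x$l*x$m))
      + w$k * ((x$0)\<^sup>2 + (x$j*x$l + x$j*x$m + x$l*x$m)) + w$l * ((x$0)\<^sup>2 + (x$j*x$k + x$j*x$m + x$k*x$m))
      + w$m * ((x$0)\<^sup>2 + (x$j*x$k + x$j*x$l + x$k*x$l))" (is ?rowi)
proof -
  note e = assms enumerates_swap[OF assms]
  have j: "enumerates j i k l m" and k: "enumerates k i j l m" and l: "enumerates l i j k m"
    and m: "enumerates m i j k l"
    using e(5) enumerates_swap by (meson assms)+
  have ik: "enumerates i k j l m" and il: "enumerates i l j k m" and im: "enumerates i m j k l"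
    using enumerates_swap assms by meson+
  show ?row0
    unfolding sum_UNIV_6 sum_enumerates[OF assms] X_hess_enumerates(1,2)[OF assms] X_hess_enumerates(2)[OF j]
      X_hess_enumerates(2)[OF k] X_hess_enumerates(2)[OF l] X_hess_enumerates(2)[OF m]
    by (simp add: algebra_simps)
  show ?rowi
    unfolding sum_UNIV_6 sum_enumerates[OF assms] X_hess_enumerates(3,4,5)[OF assms] X_hess_enumerates(5)[OF ik]
      X_hess_enumerates(5)[OF il] X_hess_enumerates(5)[OF im]
    by (simp add: algebra_simps)
qed

section \<open>The forty-five nodes\<close>

text \<open>The pair B is not recorded: it consists of the indices in {1..5} that are neither
  \<open>c\<close> nor in \<open>A\<close>.\<close>

definition R_vec :: "complex \<Rightarrow> 6 \<Rightarrow> 6 set \<Rightarrow> complex ^ 6" where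
  "R_vec \<eta> c A = (\<chi> i. if i = 0 then 1 else if i = c then \<eta> else if i \<in> A then -1 else 1)"

text \<open>An unordered pair determines the vector only up to sign; giving 1 to the smaller index
  makes it a function of the set \<open>C\<close>.\<close>

definition T_vec :: "6 set \<Rightarrow> complex ^ 6" where
  "T_vec C = (\<chi> i. if i = Min C then 1 else if i = Max C then -1 else 0)"

definition E_vec :: "complex \<Rightarrow> 6 \<Rightarrow> complex ^ 6" where
  "E_vec \<eta> c = (\<chi> i. if i = 0 then 1 else if i = c then -\<eta>/3 else \<eta>/3)"

definition R_vecs :: "complex \<Rightarrow> (complex ^ 6) set" where
  "R_vecs \<eta> = (\<lambda>(c, A). R_vec \<eta> c A) ` (SIGMA c:{1..5}. subsets_of_card 2 ({1..5} - {c}))"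

definition node_vectors :: "complex \<Rightarrow> (complex ^ 6) set" where
  "node_vectors \<eta> = R_vecs \<eta> \<union> T_vec ` subsets_of_card 2 {1..5} \<union> E_vec \<eta> ` {1..5}"

text \<open>
  The Lagrange condition for \<open>X_form\<close> on the hyperplane $u_1 + \cdots + u_5 = \eta a$.
\<close>

definition critical :: "complex \<Rightarrow> complex ^ 6 \<Rightarrow> bool" where
  "critical \<eta> x \<longleftrightarrow> x \<in> L_space \<eta> \<and> (\<forall>i\<in>{1..5}. X_partial x 0 + \<eta> * X_partial x i = 0)"

lemma singular_vector_iff_critical:
  assumes "\<eta> \<noteq> 0"
  shows "singular_vector (L_space \<eta>) X_form x \<longleftrightarrow> x \<noteq> 0 \<and> X_form x = 0 \<and> critical \<eta> x"
  using annihilates_L_space_iff[OF assms, of "X_partial x"]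
  unfolding singular_vector_def critical_def dir_deriv_X_form by blast

text \<open>
  Subtracting the partial derivatives with respect to $u_i$ and $u_j$ leaves
  $(u_j - u_i)(a^2 + e_2(u_k, u_l, u_m))$.
\<close>

lemma critical_pair:
  assumes "critical \<eta> x" "\<eta> \<noteq> 0" "enumerates i j k l m" "x $ i \<noteq> x $ j"
  shows "(x$0)\<^sup>2 + (x$k*x$l + x$k*x$m + x$l*x$m) = 0"
proof -
  have "X_partial x 0 + \<eta> * X_partial x i = 0" "X_partial x 0 + \<eta> * X_partial x j = 0"
    using assms(1) unfolding critical_def ball_enumerates[OF assms(3)] by auto
  then have "X_partial x i = X_partial x j"
    using assms(2) by (metis add_left_imp_eq mult_left_cancel)
  then have "(x$j - x$i) * ((x$0)\<^sup>2 + (x$k*x$l + x$k*x$m + x$l*x$m)) = 0"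
    unfolding X_partial_enumerates(2)[OF assms(3)] X_partial_enumerates(2)[OF enumerates_swap(1)[OF assms(3)]]
    by algebra
  then show ?thesis using assms(4) by simp
qed

section \<open>Completeness of the list of singular points\<close>

lemma R_vec_in_node_vectors:
  assumes "enumerates i j k l m"
  shows "R_vec \<eta> m {i, j} \<in> node_vectors \<eta>"
proof -
  have "{i, j} \<in> subsets_of_card 2 ({1..5} - {m})" "m \<in> {1..5}"
    using enumeratesD[OF assms] by (auto simp: subsets_of_card_def)
  then have "R_vec \<eta> m {i, j} \<in> R_vecs \<eta>"
    unfolding R_vecs_def by force
  then show ?thesis by (simp add: node_vectors_def)
qed

lemma T_vec_in_node_vectors:
  assumes "enumerates i j k l m"
  shows "T_vec {i, j} \<in> node_vectors \<eta>"
proof -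
  have "{i, j} \<in> subsets_of_card 2 {1..5}"
    using enumeratesD[OF assms] by (auto simp: subsets_of_card_def)
  then show ?thesis by (simp add: node_vectors_def)
qed

text \<open>Pattern \<open>four\<close> yields E, \<open>three\<close> yields T and
  \<open>two_two\<close> yields R. Patterns \<open>five\<close> and \<open>three_two\<close> force
  the zero vector, while in \<open>two\<close> and \<open>one\<close> differences of pair equations
  factor and make supposedly distinct coordinates equal.\<close>

lemma critical_imp_node_vector:
  assumes eta: "\<eta>\<^sup>2 = -3" and crit: "critical \<eta> x" and "x \<noteq> 0"
  obtains t y where "y \<in> node_vectors \<eta>" "x = t *s y"
proof -
  have "\<eta> \<noteq> 0" using eta by auto
  note pair = critical_pair[OF crit this]
  note swap = enumerates_swap
  have lin: "x$i + x$j + x$k + x$l + x$m = \<eta> * x$0" if "enumerates i j k l m" for i j k l m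
    using crit unfolding critical_def L_space_def sum_enumerates[OF that] by simp
  have der: "X_partial x 0 + \<eta> * X_partial x i = 0" if "enumerates i j k l m" for i j k l m
    using crit unfolding critical_def ball_enumerates[OF that] by simp
  have zero: False if "enumerates i j k l m" "x$0 = 0" "x$i = 0" "x$j = 0" "x$k = 0" "x$l = 0" "x$m = 0" for i j k l m
    using that \<open>x \<noteq> 0\<close> by (simp add: vec_eq_enumerates[OF that(1)])
  show thesis
  proof (cases rule: pattern_cases[of "($) x"])
    case (five i j k l m)
    let ?a = "x $ 0" and ?b = "x $ i"
    have "5 * ?b = \<eta> * ?a" using lin[OF five(1)] five by simp
    moreover have "4 * ?a^3 + 2 * ?a * (10 * ?b\<^sup>2) + \<eta> * (4 * ?a\<^sup>2 * ?b + 4 * ?b^3) = 0"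
      using der[OF five(1)] five unfolding X_partial_enumerates[OF five(1)]
      by (simp add: power2_eq_square power3_eq_cube algebra_simps)
    ultimately have "?a^3 = 0" using eta by algebra
    then have "?a = 0" by simp
    moreover from this have "?b = 0" using \<open>5 * ?b = \<eta> * ?a\<close> by simp
    ultimately show thesis using zero[OF five(1)] five by simp
  next
    case (four i j k l m)
    let ?a = "x $ 0" and ?b = "x $ i"
    have "enumerates i m j k l" "enumerates m i j k l" using swap four(1) by meson+
    from pair[OF this(1)] have 1: "?a\<^sup>2 + 3 * ?b\<^sup>2 = 0"
      using four by (simp add: power2_eq_square)
    have 2: "x$m = \<eta> * ?a - 4 * ?b" using lin[OF four(1)] four by (simp add: algebra_simps)
    \<comment> \<open>By \<eta>^2 = -3 this product is -3 (a^2 + 3 b^2), where b is the common value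
      of four coordinates.\<close>
    have "(\<eta> * ?a - 3 * ?b) * (\<eta> * ?a + 3 * ?b) = 0" using 1 eta by algebra
    then consider "\<eta> * ?a - 3 * ?b = 0" | "\<eta> * ?a + 3 * ?b = 0"
      using mult_eq_0_iff by blast
    then show thesis
    proof cases
      case 1
      then have b: "?b = ?a * (\<eta> / 3)" by (simp add: field_simps)
      then have "x$m = ?a * (-\<eta> / 3)" unfolding 2 by (simp add: field_simps)
      with b have "x = ?a *s E_vec \<eta> m"
        using four(1-4) enumeratesD[OF four(1)]
        by (simp add: vec_eq_enumerates[OF four(1)] E_vec_def)
      moreover have "E_vec \<eta> m \<in> node_vectors \<eta>"
        using enumeratesD[OF four(1)] unfolding node_vectors_def by simp
      ultimately show thesis using that by blast
    next
      \<comment> \<open>The other root means u_m = (7\<eta>/3) a, which the pair equations permit;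
        the full multiplier equation for the index m rules it out.\<close>
      case 3: 2
      have "4 * ?a^3 + 2 * ?a * (6 * ?b\<^sup>2 + 4 * ?b * x$m) + \<eta> * (4 * ?a\<^sup>2 * ?b + 4 * ?b^3) = 0"
        using der[OF \<open>enumerates m i j k l\<close>] four(1-5) 
        unfolding X_partial_enumerates[OF \<open>enumerates m i j k l\<close>]
        by (simp add: power2_eq_square power3_eq_cube algebra_simps)
      moreover have "3 * ?b = - \<eta> * ?a" using 3 by algebra
      ultimately have "?a^3 = 0" using eta 1 2 by algebra
      then have "?a = 0" by simp
      then show thesis using zero[OF four(1)] four 2 3 by simp
    qed
  next
    case (three_two i j k l m)
    let ?a = "x $ 0" and ?b = "x $ i" and ?c = "x $ l"
    have "enumerates i l j k m" using swap three_two(1) by meson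
    from pair[OF this] have 1: "?a\<^sup>2 + ?b\<^sup>2 + 2 * ?b * ?c = 0"
      using three_two by (simp add: power2_eq_square algebra_simps)
    have 2: "2 * ?c = \<eta> * ?a - 3 * ?b" using lin[OF three_two(1)] three_two by (simp add: algebra_simps)
    have "4 * ?a^3 + 2 * ?a * (3 * ?b\<^sup>2 + 6 * ?b * ?c + ?c\<^sup>2) 
        + \<eta> * (?a\<^sup>2 * (2 * ?b + 2 * ?c) + (2 * ?b\<^sup>2 * ?c + 2 * ?b * ?c\<^sup>2)) = 0"
      using der[OF three_two(1)] three_two unfolding X_partial_enumerates[OF three_two(1)]
      by (simp add: power2_eq_square power3_eq_cube algebra_simps)
    \<comment> \<open>Eliminating \<open>?c\<close> by \<open>2\<close> turns the left side of the
      multiplier equation into half of this product.\<close>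
    then have "(\<eta> * ?b - ?a) * (?a\<^sup>2 + 3 * ?b\<^sup>2) = 0" using 2 eta by algebra
    then consider "\<eta> * ?b - ?a = 0" | "?a\<^sup>2 + 3 * ?b\<^sup>2 = 0" by auto
    then have "?b = 0"
    proof cases
      case 1
      then have "?b^2 = 0" using \<open>?a\<^sup>2 + ?b\<^sup>2 + 2 * ?b * ?c = 0\<close> 2 eta by algebra
      then show ?thesis by simp
    next
      case 3: 2
      then have "?b^4 = 0" using 1 2 eta by algebra
      then show ?thesis by simp
    qed
    moreover from this have "?a = 0" using 1 by simp
    ultimately show thesis using zero[OF three_two(1)] three_two 2 by simp
  next
    case (three i j k l m)
    have "enumerates i l j k m" "enumerates i m j k l" "enumerates l m i j k" using swap three(1) by meson+
    from pair[OF this(1)] pair[OF this(2)] this(3)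
    have 1: "(x$0)\<^sup>2 + (x$i)\<^sup>2 + 2 * x$i * x$m = 0" "(x$0)\<^sup>2 + (x$i)\<^sup>2 + 2 * x$i * x$l = 0"
      and e: "enumerates l m i j k"
      using three by (simp_all add: power2_eq_square algebra_simps)
    then have "x$i * (x$m - x$l) = 0" by algebra
    then have "x$i = 0" using three by auto
    moreover from this have "x$0 = 0" using 1 by simp
    moreover from calculation have "x$l + x$m = 0" using lin[OF three(1)] three by simp
    then have "x$m = - x$l" by algebra
    ultimately have "x = x $ Min {l, m} *s T_vec {l, m}"
      using enumeratesD[OF e] three
      by (simp add: vec_eq_enumerates[OF e] T_vec_def min_def max_def)
    then show thesis using that T_vec_in_node_vectors[OF e] by blast
  next
    case (two_two i j k l m)
    have e: "enumerates i k j l m" "enumerates i m j k l" "enumerates k m i j l" "enumerates k l i j m"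
      using swap two_two(1) by meson+
    have 1: "(x$0)\<^sup>2 + 2 * x$i * x$k + (x$k)\<^sup>2 = 0" "(x$0)\<^sup>2 + 2 * x$i * x$k + (x$i)\<^sup>2 = 0"
      using pair[OF e(2)] pair[OF e(3)] two_two by (simp_all add: power2_eq_square algebra_simps)
    then have "(x$k - x$i) * (x$k + x$i) = 0" by algebra
    then have "x$k + x$i = 0" using two_two by auto
    then have k: "x$k = - x$i" by algebra
    then have "(x$i - x$0) * (x$i + x$0) = 0" using 1 by algebra
    \<comment> \<open>The sign decides which of the two pairs carries the value -a and hence plays
      the part of A.\<close>
    then consider "x$i = x$0" | "x$i = - x$0" by (auto simp: eq_neg_iff_add_eq_0)
    then show thesis
    proof cases
      case 1
      then have "x = x$0 *s R_vec \<eta> m {k, l}"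
        using two_two k lin[OF two_two(1)] enumeratesD[OF two_two(1)]
        by (simp add: vec_eq_enumerates[OF two_two(1)] R_vec_def)
      then show thesis using that R_vec_in_node_vectors[OF e(4)] by blast
    next
      case 2
      then have "x = x$0 *s R_vec \<eta> m {i, j}"
        using two_two k lin[OF two_two(1)] enumeratesD[OF two_two(1)]
        by (simp add: vec_eq_enumerates[OF two_two(1)] R_vec_def)
      then show thesis using that R_vec_in_node_vectors[OF two_two(1)] by blast
    qed
  next
    case (two i j k l m)
    have "enumerates i k j l m" "enumerates i l j k m" "enumerates i m j k l"
      using swap two(1) by meson+
    note e = pair[OF this(1)] pair[OF this(2)] pair[OF this(3)]
    have "(x$0)\<^sup>2 + (x$i*x$l + x$i*x$m + x$l*x$m) = 0" "(x$0)\<^sup>2 + (x$i*x$k + x$i*x$m + x$k*x$m) = 0"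
      "(x$0)\<^sup>2 + (x$i*x$k + x$i*x$l + x$k*x$l) = 0"
      using e two by simp_all
    then have "(x$l - x$k) * (x$i + x$m) = 0" "(x$m - x$k) * (x$i + x$l) = 0"
      by algebra+
    then have "x$m = - x$i" "x$l = - x$i" using two by (auto simp: eq_neg_iff_add_eq_0 add.commute)
    then show thesis using two by simp
  next
    case (one i j k l m)
    have "enumerates i k j l m" "enumerates i l j k m"
      using swap one(1) by meson+
    note e = pair[OF one(1)] pair[OF this(1)] pair[OF this(2)]
    have "(x$0)\<^sup>2 + (x$k*x$l + x$k*x$m + x$l*x$m) = 0" "(x$0)\<^sup>2 + (x$j*x$l + x$j*x$m + x$l*x$m) = 0"
      "(x$0)\<^sup>2 + (x$j*x$k + x$j*x$m + x$k*x$m) = 0"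
      using e one by simp_all
    then have "(x$k - x$j) * (x$l + x$m) = 0" "(x$l - x$j) * (x$k + x$m) = 0"
      by algebra+
    then have "x$l + x$m = 0" "x$k + x$m = 0" using one by auto
    then have "x$l = x$k" by algebra
    then show thesis using one by simp
  qed
qed

section \<open>Coordinates, gradient and Hessian at the listed points\<close>

lemma complement_of_pair:
  assumes "A \<subseteq> {1..5::6}" "card A = 2"
  obtains i j k where "{1..5} - A = {i, j, k}"
proof -
  have "card ({1..5} - A) = 3"
    using assms by (simp add: card_Diff_subset card_5 finite_subset[OF assms(1)])
  then show thesis using that by (auto simp: card_3_iff)
qed

text \<open>The ordering is adapted to the node, so that every evaluation becomes an identity in
  \<eta> alone, the same for all nodes of one kind.\<close>

lemma node_vectors_cases:
  assumes "y \<in> node_vectors \<eta>"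
  obtains (R) i j k l m where "enumerates i j k l m" "y$0 = 1" "y$i = -1" "y$j = -1" "y$k = 1" "y$l = 1" "y$m = \<eta>"
  | (T) i j k l m where "enumerates i j k l m" "y$0 = 0" "y$i = 1" "y$j = -1" "y$k = 0" "y$l = 0" "y$m = 0"
  | (E) i j k l m where "enumerates i j k l m" "y$0 = 1" "y$i = \<eta>/3" "y$j = \<eta>/3" "y$k = \<eta>/3" "y$l = \<eta>/3" "y$m = -\<eta>/3"
proof -
  consider c A where "y = R_vec \<eta> c A" "c \<in> {1..5}" "A \<in> subsets_of_card 2 ({1..5} - {c})"
    | C where "y = T_vec C" "C \<in> subsets_of_card 2 {1..5}" | c where "y = E_vec \<eta> c" "c \<in> {1..5}"
    using assms unfolding node_vectors_def R_vecs_def by (auto simp del: atLeastAtMost_iff)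
  then show thesis
  proof cases
    case 1
    then have A: "A \<subseteq> {1..5} - {c}" "card A = 2" by (auto simp: subsets_of_card_def)
    have "card ({1..5} - {c}) = 4" using 1(2) card_5 by simp
    then have "card ({1..5} - {c} - A) = 2"
      using A by (subst card_Diff_subset) (auto intro: finite_subset[OF A(1)])
    then obtain k l where B: "{1..5} - {c} - A = {k, l}" by (auto simp: card_2_iff)
    obtain i j where "A = {i, j}" using A(2) by (auto simp: card_2_iff)
    then have "{i, j, k, l, c} = {1..5}"
      using A(1) B 1(2) by blast
    then have e: "enumerates i j k l c" by (rule enumeratesI)
    note enumeratesD[OF e]
    then show thesis
      using that(1)[OF e] unfolding 1(1) \<open>A = {i, j}\<close> R_vec_def by simp
  next
    case 2
    then have C: "C \<subseteq> {1..5}" "card C = 2" by (auto simp: subsets_of_card_def)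
    then obtain p q where "C = {p, q}" "p \<noteq> q" by (auto simp: card_2_iff)
    then have C': "C = {Min C, Max C}" by (auto simp: min_def max_def)
    obtain k l m where "{1..5} - C = {k, l, m}" using complement_of_pair[OF C] .
    then have "{Min C, Max C, k, l, m} = {1..5}" using C(1) C' by blast
    then have e: "enumerates (Min C) (Max C) k l m" by (rule enumeratesI)
    note enumeratesD[OF e]
    then show thesis
      using that(2)[OF e] unfolding 2(1) T_vec_def by simp
  next
    case 3
    have "card ({1..5} - {c}) = 4" using 3(2) card_5 by simp
    moreover obtain zs where "set zs = {1..5} - {c}" "distinct zs"
      using finite_distinct_list[of "{1..5} - {c}"] by auto
    ultimately have "length zs = 4" "set zs = {1..5} - {c}" using distinct_card[of zs] by auto
    moreover from this(1) obtain i j k l where "zs = [i, j, k, l]"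
      by (auto simp: length_Suc_conv numeral_eq_Suc)
    ultimately have "{1..5} - {c} = {i, j, k, l}" by simp
    then have "{i, j, k, l, c} = {1..5}" using 3(2) by blast
    then have e: "enumerates i j k l c" by (rule enumeratesI)
    note enumeratesD[OF e]
    then show thesis
      using that(3)[OF e] unfolding 3(1) E_vec_def by simp
  qed
qed

lemma X_partial_enumerates_all:
  assumes "enumerates i j k l m"
  shows "X_partial x i = (x$0)\<^sup>2 * (x$j + x$k + x$l + x$m) + (x$j*x$k*x$l + x$j*x$k*x$m + x$j*x$l*x$m + x$k*x$l*x$m)" (is ?i)
    "X_partial x j = (x$0)\<^sup>2 * (x$i + x$k + x$l + x$m) + (x$i*x$k*x$l + x$i*x$k*x$m + x$i*x$l*x$m + x$k*x$l*x$m)" (is ?j)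
    "X_partial x k = (x$0)\<^sup>2 * (x$i + x$j + x$l + x$m) + (x$i*x$j*x$l + x$i*x$j*x$m + x$i*x$l*x$m + x$j*x$l*x$m)" (is ?k)
    "X_partial x l = (x$0)\<^sup>2 * (x$i + x$j + x$k + x$m) + (x$i*x$j*x$k + x$i*x$j*x$m + x$i*x$k*x$m + x$j*x$k*x$m)" (is ?l)
    "X_partial x m = (x$0)\<^sup>2 * (x$i + x$j + x$k + x$l) + (x$i*x$j*x$k + x$i*x$j*x$l + x$i*x$k*x$l + x$j*x$k*x$l)" (is ?m)
proof -
  have "enumerates j i k l m" "enumerates k i j l m" "enumerates l i j k m" "enumerates m i j k l"
    using enumerates_swap assms by meson+
  note this[THEN X_partial_enumerates(2)] X_partial_enumerates(2)[OF assms]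
  then show ?i ?j ?k ?l ?m by blast+
qed

lemma node_vector_singular:
  assumes eta: "\<eta>\<^sup>2 = -3" and y: "y \<in> node_vectors \<eta>"
  shows "y \<noteq> 0" "X_form y = 0" "critical \<eta> y"
proof -
  from y have "y \<noteq> 0 \<and> X_form y = 0 \<and> critical \<eta> y"
  proof (cases rule: node_vectors_cases)
    case (R i j k l m)
    have "y \<noteq> 0" using R(2) zero_index[of 0] by (metis zero_neq_one)
    then show ?thesis
      using R unfolding critical_def L_space_def sum_enumerates[OF R(1)] ball_enumerates[OF R(1)]
        X_partial_enumerates(1)[OF R(1)] X_partial_enumerates_all[OF R(1)] X_form_enumerates[OF R(1)]
      by simp
  next
    case (T i j k l m)
    have "y \<noteq> 0" using T(3) zero_index[of i] by (metis zero_neq_one)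
    then show ?thesis
      using T unfolding critical_def L_space_def sum_enumerates[OF T(1)] ball_enumerates[OF T(1)]
        X_partial_enumerates(1)[OF T(1)] X_partial_enumerates_all[OF T(1)] X_form_enumerates[OF T(1)]
      by simp
  next
    case (E i j k l m)
    have ne: "y \<noteq> 0" using E(2) zero_index[of 0] by (metis zero_neq_one)
    \<comment> \<open>In terms of s the relation is 3 s^2 = -1, which keeps the polynomial
      identities free of denominators.\<close>
    define s where "s = \<eta> / 3"
    have s: "3 * s\<^sup>2 = -1" "\<eta> = 3 * s"
      using eta by (auto simp: s_def power_divide)
    have v: "y$0 = 1" "y$i = s" "y$j = s" "y$k = s" "y$l = s" "y$m = -s" using E by (simp_all add: s_def)
    have "X_form y = 1 + 2 * s\<^sup>2 - 3 * s^4"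
      unfolding X_form_enumerates[OF E(1)] v by (simp add: power2_eq_square power4_eq_xxxx)
    then have "X_form y = 0" using s(1) by algebra
    moreover have "X_partial y 0 = 4 + 4 * s\<^sup>2"
      unfolding X_partial_enumerates(1)[OF E(1)] v by (simp add: power2_eq_square)
    moreover have "X_partial y i = 2 * s - 2 * s^3" "X_partial y j = 2 * s - 2 * s^3"
      "X_partial y k = 2 * s - 2 * s^3" "X_partial y l = 2 * s - 2 * s^3" "X_partial y m = 4 * s + 4 * s^3"
      unfolding X_partial_enumerates_all[OF E(1)] v by (simp_all add: power3_eq_cube)
    moreover have "4 + 4 * s\<^sup>2 + \<eta> * (2 * s - 2 * s^3) = 0" "4 + 4 * s\<^sup>2 + \<eta> * (4 * s + 4 * s^3) = 0"
      using s by algebra+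
    ultimately show ?thesis
      using ne unfolding critical_def ball_enumerates[OF E(1)] L_space_def sum_enumerates[OF E(1)]
      by (simp add: v s(2))
  qed
  then show "y \<noteq> 0" "X_form y = 0" "critical \<eta> y" by auto
qed

text \<open>
  The linearisation of the factorised equation in \<open>critical_pair\<close>.
\<close>

lemma hess_pair:
  assumes "enumerates i j k l m"
    and "(\<Sum>n\<in>UNIV. w $ n * X_hess x i n) = (\<Sum>n\<in>UNIV. w $ n * X_hess x j n)"
  shows "(x$j - x$i) * (2 * x$0 * w$0 + w$k * (x$l + x$m) + w$l * (x$k + x$m) + w$m * (x$k + x$l))
    + (w$j - w$i) * ((x$0)\<^sup>2 + (x$k*x$l + x$k*x$m + x$l*x$m)) = 0"
  using assms(2) unfolding X_hess_row_enumerates(2)[OF assms(1)] X_hess_row_enumerates(2)[OF enumerates_swap(1)[OF assms(1)]]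
  by algebra

text \<open>For unequal y_i, y_j the quadratic factor in \<open>hess_pair\<close> vanishes by
  \<open>critical_pair\<close>, so the bracket must vanish too. For equal ones the bracket drops
  out, and w_i = w_j follows where the quadratic factor is nonzero. Together with the equation of
  L_\<eta>, and for T one multiplier equation, this leaves only multiples of y.\<close>

lemma hess_radical:
  assumes eta: "\<eta>\<^sup>2 = -3" and y: "y \<in> node_vectors \<eta>" and w: "w \<in> L_space \<eta>"
    and rad: "\<forall>i\<in>{1..5}. (\<Sum>n\<in>UNIV. w $ n * X_hess y 0 n) + \<eta> * (\<Sum>n\<in>UNIV. w $ n * X_hess y i n) = 0"
  shows "\<exists>t. w = t *s y"
proof -
  let ?h = "\<lambda>i. \<Sum>n\<in>UNIV. w $ n * X_hess y i n"
  have eta0: "\<eta> \<noteq> 0" "\<eta> \<noteq> 1" "\<eta> \<noteq> -1" using eta by auto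
  \<comment> \<open>All rows with index in {1..5} take the common value -\<open>?h 0\<close> /
    \<eta>, so their differences vanish.\<close>
  have "a = b" if "z + \<eta> * a = 0" "z + \<eta> * b = 0" for a b z
    using that eta0(1) by (metis add_left_imp_eq mult_left_cancel)
  then have "?h i = ?h j" if "i \<in> {1..5}" "j \<in> {1..5}" for i j
    using rad that by blast
  then have pair: "(y$j - y$i) * (2 * y$0 * w$0 + w$k * (y$l + y$m) + w$l * (y$k + y$m) + w$m * (y$k + y$l))
    + (w$j - w$i) * ((y$0)\<^sup>2 + (y$k*y$l + y$k*y$m + y$l*y$m)) = 0" if "enumerates i j k l m" for i j k l m
    using that by (intro hess_pair) (auto simp: enumeratesD(7)[OF that])
  have lin: "w$i + w$j + w$k + w$l + w$m = \<eta> * w$0" if "enumerates i j k l m" for i j k l m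
    using w unfolding L_space_def sum_enumerates[OF that] by simp
  note swap = enumerates_swap
  from y show ?thesis
  proof (cases rule: node_vectors_cases)
    case (R i j k l m)
    have e: "enumerates k l i j m" "enumerates i m j k l" "enumerates k m i j l"
      using R(1) swap by meson+
    have "(w$j - w$i) * (2 * (1 + \<eta>)) = 0" "(w$l - w$k) * (2 * (1 - \<eta>)) = 0"
        "(\<eta> + 1) * (2 * (w$0 + w$j)) = 0" "(\<eta> - 1) * (2 * (w$0 - w$l)) = 0"
      using pair[OF R(1)] pair[OF e(1)] pair[OF e(2)] pair[OF e(3)] R by (simp_all add: algebra_simps)
    moreover have n: "1 + \<eta> \<noteq> 0" "1 - \<eta> \<noteq> 0" "\<eta> + 1 \<noteq> 0" "\<eta> - 1 \<noteq> 0"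
      using eta0 by (auto simp: eq_neg_iff_add_eq_0 add.commute)
    moreover from n have "2 * (1 + \<eta>) \<noteq> 0" "2 * (1 - \<eta>) \<noteq> 0"
      by (metis mult_eq_0_iff zero_neq_numeral)+
    ultimately have "w$j - w$i = 0" "w$l - w$k = 0" "w$0 + w$j = 0" "w$0 - w$l = 0"
      by (simp_all only: mult_eq_0_iff) simp_all
    then have "w$i = - w$0" "w$j = - w$0" "w$k = w$0" "w$l = w$0" by algebra+
    moreover from this have "w$m = w$0 * \<eta>" using lin[OF R(1)] by simp
    ultimately have "w = w$0 *s y" using R by (simp add: vec_eq_enumerates[OF R(1)])
    then show ?thesis ..
  next
    case (T i j k l m)
    have e: "enumerates k l i j m" "enumerates k m i j l" "enumerates k i j l m"
      using T(1) swap by meson+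
    have "w$l = w$k" "w$m = w$k" "w$l + w$m = 0"
      using pair[OF e(1)] pair[OF e(2)] pair[OF e(3)] T by (simp_all add: algebra_simps)
    then have 0: "w$k = 0" "w$l = 0" "w$m = 0" by simp_all
    \<comment> \<open>Since a = 0 at T, the pair equations do not involve w_0; an undifferenced
      equation is needed to see it.\<close>
    have "?h 0 + \<eta> * ?h k = 0" using rad enumeratesD(7)[OF T(1)] by blast
    then have "w$0 = 0"
      using T 0 unfolding X_hess_row_enumerates(1)[OF T(1)] X_hess_row_enumerates(2)[OF e(3)] by simp
    moreover from this have "w$j = - w$i" using lin[OF T(1)] 0 by (simp add: eq_neg_iff_add_eq_0 add.commute)
    ultimately have "w = w$i *s y" using T 0 by (simp add: vec_eq_enumerates[OF T(1)])
    then show ?thesis ..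
  next
    case (E i j k l m)
    define s where "s = \<eta> / 3"
    have s: "3 * s\<^sup>2 = -1" "\<eta> = 3 * s" "s \<noteq> 0" 
      using eta eta0 by (auto simp: s_def power_divide)
    have v: "y$i = s" "y$j = s" "y$k = s" "y$l = s" "y$m = -s" using E by (simp_all add: s_def)
    have e: "enumerates i k j l m" "enumerates i l j k m" "enumerates i m j k l"
      using E(1) swap by meson+
    have *: "(w$j - w$i) * (1 - s\<^sup>2) = 0" "(w$k - w$i) * (1 - s\<^sup>2) = 0" "(w$l - w$i) * (1 - s\<^sup>2) = 0"
        "- 2 * s * (2 * w$0 + 2 * s * (w$j + w$k + w$l)) + (w$m - w$i) * (1 + 3 * s\<^sup>2) = 0"
      using pair[OF E(1)] pair[OF e(1)] pair[OF e(2)] pair[OF e(3)] E(2) v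
      by (simp_all add: algebra_simps power2_eq_square)
    have "1 - s\<^sup>2 \<noteq> 0" using s(1) by auto
    then have 1: "w$j - w$i = 0" "w$k - w$i = 0" "w$l - w$i = 0"
      using * by (metis mult_eq_0_iff)+
    have "s * (w$0 + s * (w$j + w$k + w$l)) = 0" using *(4) s(1) by algebra
    with 1 have "w$j - w$i = 0 \<and> w$k - w$i = 0 \<and> w$l - w$i = 0 \<and> w$0 + s * (w$j + w$k + w$l) = 0"
      using s(3) by (metis mult_eq_0_iff)
    then have "w$i = w$0 * s" using s(1) by algebra
    moreover from this 1 have "w$j = w$0 * s" "w$k = w$0 * s" "w$l = w$0 * s" by simp_all
    moreover from calculation have "w$m = w$0 * (- s)" using lin[OF E(1)] s(2) by algebra
    ultimately have "w = w$0 *s y" using E(2) v by (simp add: vec_eq_enumerates[OF E(1)])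
    then show ?thesis ..
  qed
qed

section \<open>Nondegeneracy and the list of nodes\<close>

lemma subspace_L_space: "vec.subspace (L_space \<eta>)"
  unfolding L_space_def vec.subspace_def
  by (auto simp: sum.distrib sum_distrib_left[symmetric] algebra_simps)

lemma enumerates_1_5: "enumerates 1 2 3 4 5"
  by (rule enumeratesI) (simp add: atLeastAtMost_1_5)

text \<open>Euler's relation for the partial derivatives, which are cubic forms. It puts a singular
  vector into the radical of the Hessian.\<close>

lemma X_hess_euler:
  assumes "i \<in> {1..5}"
  shows "(\<Sum>n\<in>UNIV. x $ n * X_hess x 0 n) = 3 * X_partial x 0" (is ?A)
    and "(\<Sum>n\<in>UNIV. x $ n * X_hess x i n) = 3 * X_partial x i" (is ?B)
proof -
  have "i \<in> {1, 2, 3, 4, 5}" using assms atLeastAtMost_1_5 by blast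
  moreover have "enumerates 1 2 3 4 5" "enumerates 2 1 3 4 5" "enumerates 3 1 2 4 5" "enumerates 4 1 2 3 5" "enumerates 5 1 2 3 4"
    by (intro enumeratesI; simp add: atLeastAtMost_1_5 insert_commute)+
  ultimately obtain j k l m where e: "enumerates i j k l m" by blast
  show ?A
    unfolding X_hess_row_enumerates[OF e] X_partial_enumerates[OF e] by algebra
  show ?B
    unfolding X_hess_row_enumerates[OF e] X_partial_enumerates[OF e] by algebra
qed

lemma node_vector_radical:
  assumes eta: "\<eta>\<^sup>2 = -3" and y: "y \<in> node_vectors \<eta>"
  shows "{w \<in> L_space \<eta>. \<forall>v\<in>L_space \<eta>. dir_deriv v (dir_deriv w X_form) y = 0} = vec.span {y}"
proof -
  have "\<eta> \<noteq> 0" using eta by auto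
  have iff: "(\<forall>v\<in>L_space \<eta>. dir_deriv v (dir_deriv w X_form) y = 0) \<longleftrightarrow>
     (\<forall>i\<in>{1..5}. (\<Sum>n\<in>UNIV. w $ n * X_hess y 0 n) + \<eta> * (\<Sum>n\<in>UNIV. w $ n * X_hess y i n) = 0)" for w
    unfolding dir_deriv_dir_deriv_X_form using annihilates_L_space_iff[OF \<open>\<eta> \<noteq> 0\<close>] .
  have crit: "critical \<eta> y" using node_vector_singular[OF assms] by simp
  have "(\<Sum>n\<in>UNIV. (t *s y) $ n * X_hess y 0 n) + \<eta> * (\<Sum>n\<in>UNIV. (t *s y) $ n * X_hess y i n) = 0"
    if "i \<in> {1..5}" for t i
  proof -
    have *: "(\<Sum>n\<in>UNIV. (t *s y) $ n * X_hess y j n) = t * (\<Sum>n\<in>UNIV. y $ n * X_hess y j n)" for j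
      by (simp add: sum_distrib_left mult.assoc)
    have "X_partial y 0 + \<eta> * X_partial y i = 0"
      using crit that by (simp add: critical_def)
    then show ?thesis
      unfolding * X_hess_euler[OF that] by algebra
  qed
  moreover have "t *s y \<in> L_space \<eta>" for t
    using crit subspace_L_space vec.subspace_scale unfolding critical_def by blast
  ultimately show ?thesis
    unfolding iff vec.span_singleton using hess_radical[OF assms] by blast
qed

lemma span_singleton_scale: "t \<noteq> 0 \<Longrightarrow> vec.span {t *s x} = vec.span {x :: complex ^ 'n}"
  by (rule vec.span_image_scale[of "{x}" "\<lambda>_. t", simplified]) 

lemma nodes_eq:
  assumes eta: "\<eta>\<^sup>2 = -3"
  shows "nodes (L_space \<eta>) X_form = (\<lambda>y. vec.span {y}) ` node_vectors \<eta>"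
proof -
  have "\<eta> \<noteq> 0" using eta by auto
  note sing = singular_vector_iff_critical[OF this]
  show ?thesis
  proof (intro set_eqI iffI)
    fix P assume "P \<in> nodes (L_space \<eta>) X_form"
    then obtain x where x: "P = vec.span {x}" "critical \<eta> x" "x \<noteq> 0"
      unfolding nodes_def sing by blast
    then obtain t y where y: "y \<in> node_vectors \<eta>" "x = t *s y"
      using critical_imp_node_vector[OF eta] by blast
    then have "t \<noteq> 0" using x by auto
    then show "P \<in> (\<lambda>y. vec.span {y}) ` node_vectors \<eta>"
      using x y span_singleton_scale by auto
  next
    fix P assume "P \<in> (\<lambda>y. vec.span {y}) ` node_vectors \<eta>"
    then obtain y where "y \<in> node_vectors \<eta>" "P = vec.span {y}" by blast
    then show "P \<in> nodes (L_space \<eta>) X_form"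
      unfolding nodes_def sing using node_vector_singular[OF eta] node_vector_radical[OF eta] by blast
  qed
qed

section \<open>Hyperplanes and their incidence with the nodes\<close>

text \<open>
  The forms $u_i - \frac{\eta}{3} a$ $(1 \le i \le 5)$ are coordinates on \<open>L_space \<eta>\<close> in which, up
  to scalars, $E_c$ is the unit vector $e_c$, $T_{\{p, q\}}$ is $e_p - e_q$ and $R_{A,B;c}$ is
  $e_c + \zeta \sum_{i \in A} e_i + \zeta^2 \sum_{j \in B} e_j$.
\<close>

definition pairing :: "complex \<Rightarrow> (6 \<Rightarrow> complex) \<Rightarrow> complex ^ 6 \<Rightarrow> complex" where
  "pairing \<eta> c x = (\<Sum>i\<in>{1..5}. c i * (x $ i - \<eta> / 3 * x $ 0))"

definition hyp :: "complex \<Rightarrow> (6 \<Rightarrow> complex) \<Rightarrow> (complex ^ 6) set" where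
  "hyp \<eta> c = {x \<in> L_space \<eta>. pairing \<eta> c x = 0}"

lemma pairing_add: "pairing \<eta> c (x + y) = pairing \<eta> c x + pairing \<eta> c y"
  unfolding pairing_def sum.distrib[symmetric] by (intro sum.cong) (auto simp: algebra_simps)

lemma pairing_scale: "pairing \<eta> c (t *s x) = t * pairing \<eta> c x"
  unfolding pairing_def sum_distrib_left by (intro sum.cong) (auto simp: algebra_simps)

lemma pairing_diff: "pairing \<eta> c (x - y) = pairing \<eta> c x - pairing \<eta> c y"
  unfolding pairing_def sum_subtractf[symmetric] by (intro sum.cong) (auto simp: algebra_simps)

lemma subspace_hyp: "vec.subspace (hyp \<eta> c)"
proof (unfold vec.subspace_def, intro conjI allI ballI)
  show "0 \<in> hyp \<eta> c"
    using vec.subspace_0[OF subspace_L_space] by (simp add: hyp_def pairing_def)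
next
  fix x y assume "x \<in> hyp \<eta> c" "y \<in> hyp \<eta> c"
  then show "x + y \<in> hyp \<eta> c"
    using vec.subspace_add[OF subspace_L_space] by (simp add: hyp_def pairing_add)
next
  fix t x assume "x \<in> hyp \<eta> c"
  then show "t *s x \<in> hyp \<eta> c"
    using vec.subspace_scale[OF subspace_L_space] by (simp add: hyp_def pairing_scale)
qed

lemma node_vectors_subset: "\<eta>\<^sup>2 = -3 \<Longrightarrow> node_vectors \<eta> \<subseteq> L_space \<eta>"
  using node_vector_singular(3) by (auto simp: critical_def)

lemma pairing_E_vec:
  assumes "p \<in> {1..5}"
  shows "pairing \<eta> c (E_vec \<eta> p) = - 2 * \<eta> / 3 * c p"
proof -
  have "pairing \<eta> c (E_vec \<eta> p) = (\<Sum>i\<in>{1..5}. if i = p then - 2 * \<eta> / 3 * c p else 0)"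
    unfolding pairing_def by (intro sum.cong) (auto simp: E_vec_def field_simps)
  then show ?thesis using assms by simp
qed

text \<open>A coefficient \<open>c p \<noteq> 0\<close> places E_p outside \<open>hyp\<close>, and
  every vector of L_\<eta> differs from a multiple of E_p by an element of \<open>hyp\<close>; so
  the dimension drops by exactly one.\<close>

lemma hyperplane_of_hyp:
  assumes eta: "\<eta>\<^sup>2 = -3" and p: "p \<in> {1..5}" "c p \<noteq> 0"
  shows "hyperplane_of (L_space \<eta>) (hyp \<eta> c)"
proof -
  let ?v = "E_vec \<eta> p" and ?H = "hyp \<eta> c"
  have "\<eta> \<noteq> 0" using eta by auto
  then have v0: "pairing \<eta> c ?v \<noteq> 0" using p by (simp add: pairing_E_vec)
  have v: "?v \<in> L_space \<eta>"
    using node_vectors_subset[OF eta] p(1) unfolding node_vectors_def by blast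
  have sub: "?H \<subseteq> L_space \<eta>" by (auto simp: hyp_def)
  have "vec.span (insert ?v ?H) = L_space \<eta>"
  proof
    show "vec.span (insert ?v ?H) \<subseteq> L_space \<eta>"
      using v sub by (intro vec.span_minimal subspace_L_space) auto
    show "L_space \<eta> \<subseteq> vec.span (insert ?v ?H)"
    proof
      fix x assume x: "x \<in> L_space \<eta>"
      let ?k = "pairing \<eta> c x / pairing \<eta> c ?v"
      have "x - ?k *s ?v \<in> L_space \<eta>"
        by (intro vec.subspace_diff vec.subspace_scale subspace_L_space x v)
      then have "x - ?k *s ?v \<in> ?H"
        using v0 by (simp add: hyp_def pairing_diff pairing_scale)
      then show "x \<in> vec.span (insert ?v ?H)"
        unfolding vec.span_breakdown_eq using vec.span_base by blast
    qed
  qed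
  then have "vec.dim (L_space \<eta>) = vec.dim (insert ?v ?H)"
    using vec.dim_span by metis
  moreover have sp: "vec.span ?H = ?H" using vec.span_eq_iff subspace_hyp by blast
  have "?v \<notin> vec.span ?H" unfolding sp using v0 by (simp add: hyp_def)
  ultimately show ?thesis
    unfolding hyperplane_of_def using sub subspace_hyp by (simp add: vec.dim_insert)
qed

text \<open>A basis of \<open>H\<close> is extended by one vector of \<open>V\<close> outside
  \<open>H\<close>; the form is a functional that vanishes on the basis but not at that
  vector.\<close>

lemma hyperplane_imp_linear_form:
  fixes V H :: "(complex ^ 'n) set"
  assumes V: "vec.subspace V" and H: "hyperplane_of V H"
  obtains a :: "'n \<Rightarrow> complex" where "H = {x \<in> V. (\<Sum>n\<in>UNIV. a n * x $ n) = 0}"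
proof -
  have sH: "vec.subspace H" and HV: "H \<subseteq> V" and dim: "vec.dim H + 1 = vec.dim V"
    using H by (auto simp: hyperplane_of_def)
  then obtain v where v: "v \<in> V" "v \<notin> H"
    by (metis add_eq_self_zero equalityI one_neq_zero subsetI)
  have span_H: "vec.span H = H" using sH by (simp add: vec.span_eq_iff)
  have "vec.span (insert v H) = V"
  proof (rule vec.subspace_dim_equal)
    show "vec.span (insert v H) \<subseteq> V" using v HV V by (intro vec.span_minimal) auto
    show "vec.dim V \<le> vec.dim (vec.span (insert v H))"
      unfolding vec.dim_span vec.dim_insert span_H using v dim by simp
  qed (use V in auto)
  then have split: "\<exists>k. x - k *s v \<in> H" if "x \<in> V" for x
    using that vec.span_breakdown_eq[of x v H] span_H by auto
  obtain B where B: "vec.independent B" "vec.span B = H" "B \<subseteq> H"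
    using vec.basis_subspace_exists[OF sH] by metis
  then have "vec.independent (insert v B)"
    using v by (simp add: vec.independent_insert)
  \<comment> \<open>The extension takes values in \<open>complex ^ 'n\<close>, so that it has a
    matrix. Its value at \<open>v\<close> is the all-ones vector, hence any single component
    \<open>n0\<close> serves as the functional.\<close>
  then obtain g :: "complex ^ 'n \<Rightarrow> complex ^ 'n" where g: "Vector_Spaces.linear (*s) (*s) g"
    "\<forall>x\<in>insert v B. g x = (if x = v then 1 else 0)"
    using vec.linear_independent_extend[of "insert v B" "\<lambda>x. if x = v then 1 else 0"] by blast
  have g0: "g x = 0" if "x \<in> H" for x
  proof -
    have "g b = 0" if "b \<in> B" for b using that g(2) B(3) v(2) by auto
    then show ?thesis
      using vec.linear_eq_0_on_span[OF g(1), of B x] that B(2) by simp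
  qed
  have gv: "g v = 1" using g(2) by simp
  obtain n0 :: 'n where True by blast
  have H_iff: "x \<in> H \<longleftrightarrow> g x $ n0 = 0" if x: "x \<in> V" for x
  proof
    assume z: "g x $ n0 = 0"
    from split[OF x] obtain k where k: "x - k *s v \<in> H" by blast
    have "g x = g (x - k *s v) + g (k *s v)"
      using vec.linear_add[OF g(1), of "x - k *s v" "k *s v"] by simp
    also have "\<dots> = k *s 1"
      using g0[OF k] vec.linear_scale[OF g(1), of k v] gv by simp
    finally have "k = 0" using z by simp
    with k show "x \<in> H" by simp
  qed (simp add: g0)
  have "g x $ n0 = (\<Sum>n\<in>UNIV. matrix g $ n0 $ n * x $ n)" for x
    unfolding matrix_works[OF g(1), of x, symmetric] by (simp add: matrix_vector_mult_def)
  then have "H = {x \<in> V. (\<Sum>n\<in>UNIV. matrix g $ n0 $ n * x $ n) = 0}"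
    using H_iff HV by auto
  then show thesis by (rule that)
qed

lemma hyperplane_imp_hyp:
  assumes eta: "\<eta>\<^sup>2 = -3" and H: "hyperplane_of (L_space \<eta>) H"
  obtains c p where "H = hyp \<eta> c" "p \<in> {1..5}" "c p \<noteq> 0"
proof -
  have eta0: "\<eta> \<noteq> 0" using eta by auto
  obtain a where a: "H = {x \<in> L_space \<eta>. (\<Sum>n\<in>UNIV. a n * x $ n) = 0}"
    using hyperplane_imp_linear_form[OF subspace_L_space H] .
  define s where "s = (\<Sum>i\<in>{1..5}. a i)"
  \<comment> \<open>Modulo the equation of L_\<eta> every a_i may be lowered by t if a_0 is raised
    by \<eta> t. This t makes the coefficient of x_0 equal to -\<eta>/3 times the sum of the new
    coefficients, the shape of \<open>pairing\<close>.\<close>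
  define t where "t = 3 / (2 * \<eta>) * (a 0 + \<eta> * s / 3)"
  define c where "c i = a i - t" for i
  have "pairing \<eta> c x = (\<Sum>n\<in>UNIV. a n * x $ n)" if "x \<in> L_space \<eta>" for x
  proof -
    have "pairing \<eta> c x = (\<Sum>i\<in>{1..5}. a i * x $ i) - t * (\<Sum>i\<in>{1..5}. x $ i) - (s - 5 * t) * (\<eta> / 3 * x $ 0)"
      unfolding pairing_def c_def s_def sum_enumerates[OF enumerates_1_5] by (simp add: field_simps)
    also have "\<dots> = (\<Sum>i\<in>{1..5}. a i * x $ i) + (2 * t * \<eta> / 3 - \<eta> * s / 3) * x $ 0"
      using that by (simp add: L_space_def field_simps)
    also have "2 * t * \<eta> / 3 - \<eta> * s / 3 = a 0"
      unfolding t_def using eta0 by (simp add: field_simps)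
    finally show ?thesis by (simp add: sum_UNIV_6)
  qed
  then have Hc: "H = hyp \<eta> c" unfolding a hyp_def by auto
  have "\<exists>p\<in>{1..5}. c p \<noteq> 0"
  proof (rule ccontr)
    assume "\<not> ?thesis"
    then have "pairing \<eta> c x = 0" for x
      unfolding pairing_def by (intro sum.neutral) auto
    then have "H = L_space \<eta>" using Hc by (simp add: hyp_def)
    then show False using H by (simp add: hyperplane_of_def)
  qed
  then show thesis using that Hc by blast
qed

lemma hyp_scale: "t \<noteq> 0 \<Longrightarrow> (\<And>i. i \<in> {1..5} \<Longrightarrow> d i = t * c i) \<Longrightarrow> hyp \<eta> d = hyp \<eta> c"
proof -
  assume t: "t \<noteq> 0" "\<And>i. i \<in> {1..5} \<Longrightarrow> d i = t * c i"
  have "pairing \<eta> d x = t * pairing \<eta> c x" for x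
    unfolding pairing_def sum_distrib_left using t(2) by (intro sum.cong) auto
  then show ?thesis using t(1) by (simp add: hyp_def)
qed

text \<open>The vector d_q E_p - d_p E_q lies in the hyperplane of d, and its pairing with c is a
  multiple of this 2 by 2 minor. Later the minors serve to tell hyperplanes apart.\<close>

lemma hyp_eq_imp_proportional:
  assumes eta: "\<eta>\<^sup>2 = -3" and eq: "hyp \<eta> c = hyp \<eta> d" and pq: "p \<in> {1..5}" "q \<in> {1..5}"
  shows "c p * d q = c q * d p"
proof -
  have eta0: "\<eta> \<noteq> 0" using eta by auto
  let ?x = "d q *s E_vec \<eta> p - d p *s E_vec \<eta> q"
  have "E_vec \<eta> p \<in> L_space \<eta>" "E_vec \<eta> q \<in> L_space \<eta>"
    using node_vectors_subset[OF eta] pq unfolding node_vectors_def by blast+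
  then have "?x \<in> L_space \<eta>"
    by (intro vec.subspace_diff vec.subspace_scale subspace_L_space)
  then have "?x \<in> hyp \<eta> d"
    using pq by (simp add: hyp_def pairing_diff pairing_scale pairing_E_vec)
  then have "pairing \<eta> c ?x = 0" unfolding eq[symmetric] by (simp add: hyp_def)
  then have "- 2 * \<eta> / 3 * (c p * d q - c q * d p) = 0"
    using pq by (auto simp: pairing_diff pairing_scale pairing_E_vec algebra_simps)
  then show ?thesis using eta0 by auto
qed

section \<open>Distinctness of the nodes\<close>

lemma inj_on_E_vec:
  assumes "\<eta> \<noteq> 0"
  shows "inj_on (E_vec \<eta>) {1..5}"
proof (rule inj_onI)
  fix p q :: 6 assume pq: "p \<in> {1..5}" "E_vec \<eta> p = E_vec \<eta> q"
  then have "E_vec \<eta> p $ p = E_vec \<eta> q $ p" by simp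
  then show "p = q" using pq(1) assms by (auto simp: E_vec_def split: if_splits)
qed

lemma T_vec_support:
  assumes "C \<in> subsets_of_card 2 {1..5}"
  shows "{i. T_vec C $ i \<noteq> 0} = C" "T_vec C $ 0 = 0" "T_vec C $ Min C = 1"
proof -
  have C: "C \<subseteq> {1..5}" "card C = 2" using assms by (auto simp: subsets_of_card_def)
  then obtain p q where pq: "C = {p, q}" "p \<noteq> q" by (auto simp: card_2_iff)
  then show "{i. T_vec C $ i \<noteq> 0} = C" "T_vec C $ Min C = 1"
    by (auto simp: T_vec_def min_def max_def)
  have "p \<noteq> 0" "q \<noteq> 0" using pq C(1) by auto
  then show "T_vec C $ 0 = 0" using pq by (auto simp: T_vec_def min_def max_def)
qed

lemma inj_on_T_vec: "inj_on T_vec (subsets_of_card 2 {1..5})"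
  by (intro inj_onI) (metis T_vec_support(1))

text \<open>Since \<eta> is neither 1 nor -1, \<open>c\<close> is the only nonzero index with value
  \<eta>, and \<open>A\<close> is the set of indices with value -1.\<close>

lemma inj_on_R_vec:
  assumes "\<eta>\<^sup>2 = -3"
  shows "inj_on (\<lambda>(c, A). R_vec \<eta> c A) (SIGMA c:{1..5}. subsets_of_card 2 ({1..5} - {c}))"
proof (rule inj_onI, clarify)
  have eta: "\<eta> \<noteq> 1" "\<eta> \<noteq> -1" using assms by auto
  fix c A d B assume *: "c \<in> {1..5}" "d \<in> {1..5}" "A \<in> subsets_of_card 2 ({1..5} - {c})"
    "B \<in> subsets_of_card 2 ({1..5} - {d})" and eq: "R_vec \<eta> c A = R_vec \<eta> d B"
  have "{i. i \<noteq> 0 \<and> R_vec \<eta> c A $ i = \<eta>} = {c}" "{i. i \<noteq> 0 \<and> R_vec \<eta> d B $ i = \<eta>} = {d}"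
    using eta *(1,2) by (auto simp: R_vec_def split: if_splits)
  moreover have "{i. R_vec \<eta> c A $ i = -1} = A" "{i. R_vec \<eta> d B $ i = -1} = B"
    using eta * by (auto simp: R_vec_def subsets_of_card_def split: if_splits)
  ultimately show "c = d \<and> A = B" using eq by auto
qed


lemma span_subset_iff: "vec.subspace H \<Longrightarrow> vec.span {y} \<subseteq> H \<longleftrightarrow> y \<in> H"
  using vec.span_minimal[of "{y}" H] vec.span_base[of y "{y}"] by auto

lemma node_vector_0:
  assumes "y \<in> node_vectors \<eta>"
  shows "y $ 0 = 1 \<or> (\<exists>C\<in>subsets_of_card 2 {1..5}. y = T_vec C)"
  using assms unfolding node_vectors_def R_vecs_def by (auto simp: R_vec_def E_vec_def)

text \<open>Vectors R and E are normalised by a = 1, which forces the scalar to be 1. Vectors T have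
  a = 0 and are recovered from their support, which ignores scaling.\<close>

lemma inj_on_span_node_vectors:
  assumes eta: "\<eta>\<^sup>2 = -3"
  shows "inj_on (\<lambda>y. vec.span {y}) (node_vectors \<eta>)"
proof (rule inj_onI)
  fix y z assume y: "y \<in> node_vectors \<eta>" and z: "z \<in> node_vectors \<eta>" and eq: "vec.span {y} = vec.span {z}"
  have "y \<in> vec.span {z}" unfolding eq[symmetric] by (simp add: vec.span_base)
  then obtain t where t: "y = t *s z" unfolding vec.span_singleton by blast
  have "y \<noteq> 0" using node_vector_singular(1)[OF eta y] .
  then have "t \<noteq> 0" using t by auto
  show "y = z"
  proof (cases "z $ 0 = 1")
    case True
    then have "y $ 0 = t" using t by simp
    moreover have "y $ 0 = 1 \<or> y $ 0 = 0" using node_vector_0[OF y] T_vec_support(2) by auto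
    ultimately have "t = 1" using \<open>t \<noteq> 0\<close> by simp
    then show ?thesis using t by simp
  next
    case False
    then obtain C where C: "C \<in> subsets_of_card 2 {1..5}" "z = T_vec C"
      using node_vector_0[OF z] by blast
    then have "y $ 0 = 0" using t T_vec_support(2) by simp
    then obtain D where D: "D \<in> subsets_of_card 2 {1..5}" "y = T_vec D"
      using node_vector_0[OF y] by auto
    have "{i. y $ i \<noteq> 0} = {i. z $ i \<noteq> 0}" using t \<open>t \<noteq> 0\<close> by simp
    then show ?thesis using T_vec_support(1)[OF C(1)] T_vec_support(1)[OF D(1)] C(2) D(2) by simp
  qed
qed

lemma card_nodes_subset:
  assumes eta: "\<eta>\<^sup>2 = -3" and H: "vec.subspace H"
  shows "card {P \<in> nodes (L_space \<eta>) X_form. P \<subseteq> H} = card {y \<in> node_vectors \<eta>. y \<in> H}"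
proof -
  have "{P \<in> nodes (L_space \<eta>) X_form. P \<subseteq> H} = (\<lambda>y. vec.span {y}) ` {y \<in> node_vectors \<eta>. y \<in> H}"
    unfolding nodes_eq[OF eta] using span_subset_iff[OF H] by blast
  moreover have "inj_on (\<lambda>y. vec.span {y}) {y \<in> node_vectors \<eta>. y \<in> H}"
    using inj_on_span_node_vectors[OF eta] by (rule inj_on_subset) auto
  ultimately show ?thesis by (simp add: card_image)
qed

section \<open>Counting the nodes on a hyperplane\<close>

lemma finite_R_index: "finite (SIGMA c:{1..5::6}. subsets_of_card 2 ({1..5} - {c}))"
  by (intro finite_SigmaI finite_subsets_of_card) auto

text \<open>The three families are disjoint: a = 0 only for T, and an entry -1 occurs in every R but
  in no E. The count is written with \<open>of_bool\<close> so that it expands over explicit index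
  lists.\<close>

lemma card_node_vectors:
  assumes eta: "\<eta>\<^sup>2 = -3"
  shows "card {y \<in> node_vectors \<eta>. Q y} =
    (\<Sum>p\<in>{1..5}. \<Sum>A\<in>subsets_of_card 2 ({1..5} - {p}). of_bool (Q (R_vec \<eta> p A))) +
    (\<Sum>C\<in>subsets_of_card 2 {1..5}. of_bool (Q (T_vec C))) + (\<Sum>p\<in>{1..5}. of_bool (Q (E_vec \<eta> p)))"
proof -
  let ?T = "T_vec ` subsets_of_card 2 {1..5}" and ?E = "E_vec \<eta> ` {1..5}"
  have "\<eta> \<noteq> 0" "\<eta> \<noteq> 3" "\<eta> \<noteq> -3" using eta by auto
  then have eta0: "\<eta> \<noteq> 0" "\<eta> / 3 \<noteq> -1" "- \<eta> / 3 \<noteq> -1"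
    by (auto simp: divide_eq_eq)
  have fin: "finite (R_vecs \<eta>)" "finite ?T" "finite ?E"
    unfolding R_vecs_def using finite_R_index by (auto intro!: finite_subsets_of_card)
  have "y $ 0 = 1 \<and> (\<exists>i. y $ i = -1)" if "y \<in> R_vecs \<eta>" for y
  proof -
    obtain c A where y: "y = R_vec \<eta> c A" "A \<in> subsets_of_card 2 ({1..5} - {c})"
      using \<open>y \<in> R_vecs \<eta>\<close> unfolding R_vecs_def by auto
    then have "A \<noteq> {}" "A \<subseteq> {1..5} - {c}" by (auto simp: subsets_of_card_def)
    then obtain i where "i \<in> A" by blast
    moreover from this have "i \<noteq> 0" "i \<noteq> c" using \<open>A \<subseteq> {1..5} - {c}\<close> by auto
    ultimately show ?thesis unfolding y(1) by (auto simp: R_vec_def intro!: exI[of _ i])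
  qed
  moreover have "y $ 0 = 1 \<and> (\<forall>i. y $ i \<noteq> -1)" if "y \<in> ?E" for y
    using that eta0 by (auto simp: E_vec_def split: if_splits)
  moreover have "y $ 0 = 0" if "y \<in> ?T" for y
    using that T_vec_support(2) by auto
  ultimately have disj: "R_vecs \<eta> \<inter> ?T = {}" "(R_vecs \<eta> \<union> ?T) \<inter> ?E = {}"
    by fastforce+
  have "card {y \<in> node_vectors \<eta>. Q y} = (\<Sum>y\<in>node_vectors \<eta>. of_bool (Q y))"
    using fin by (simp add: node_vectors_def of_bool_def sum.If_cases Int_def)
  also have "\<dots> = (\<Sum>y\<in>R_vecs \<eta>. of_bool (Q y)) + (\<Sum>y\<in>?T. of_bool (Q y)) + (\<Sum>y\<in>?E. of_bool (Q y))"
    unfolding node_vectors_def sum.union_disjoint[OF finite_UnI[OF fin(1,2)] fin(3) disj(2)]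
      sum.union_disjoint[OF fin(1,2) disj(1)] ..
  also have "(\<Sum>y\<in>R_vecs \<eta>. of_bool (Q y)) =
      (\<Sum>p\<in>{1..5}. \<Sum>A\<in>subsets_of_card 2 ({1..5} - {p}). of_bool (Q (R_vec \<eta> p A)))"
    unfolding R_vecs_def sum.reindex[OF inj_on_R_vec[OF eta]]
    by (subst sum.Sigma) (auto simp del: sum_of_bool_eq simp: case_prod_unfold intro!: finite_subsets_of_card)
  also have "(\<Sum>y\<in>?T. of_bool (Q y)) = (\<Sum>C\<in>subsets_of_card 2 {1..5}. of_bool (Q (T_vec C)))"
    unfolding sum.reindex[OF inj_on_T_vec] by (simp only: o_def)
  also have "(\<Sum>y\<in>?E. of_bool (Q y)) = (\<Sum>p\<in>{1..5}. of_bool (Q (E_vec \<eta> p)))"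
    unfolding sum.reindex[OF inj_on_E_vec[OF eta0(1)]] by (simp only: o_def)
  finally show ?thesis .
qed

lemma R_vec_in_hyp:
  assumes eta: "\<eta>\<^sup>2 = -3" and zeta: "\<zeta> = (-1 + \<eta>) / 2" and e: "enumerates i j k l m"
  shows "R_vec \<eta> i {j, k} \<in> hyp \<eta> c \<longleftrightarrow> c i + \<zeta> * (c j + c k) + \<zeta>\<^sup>2 * (c l + c m) = 0"
proof -
  have eta0: "\<eta> \<noteq> 0" using eta by auto
  have "enumerates j k l m i" using enumerates_swap e by meson
  then have "R_vec \<eta> i {j, k} \<in> L_space \<eta>"
    using R_vec_in_node_vectors node_vectors_subset[OF eta] by blast
  moreover have "pairing \<eta> c (R_vec \<eta> i {j, k}) = c i * (\<eta> - \<eta> / 3) + c j * (- 1 - \<eta> / 3) + c k * (- 1 - \<eta> / 3)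
      + c l * (1 - \<eta> / 3) + c m * (1 - \<eta> / 3)"
    using enumeratesD[OF e] unfolding pairing_def sum_enumerates[OF e] by (simp add: R_vec_def)
  \<comment> \<open>The coordinates y of R are 2\<eta>/3 times \<zeta> on A, \<zeta>^2 on B and 1 at
    the remaining index, so a common factor can be cancelled.\<close>
  moreover have "- 1 - \<eta> / 3 = 2 * \<eta> / 3 * \<zeta>" "1 - \<eta> / 3 = 2 * \<eta> / 3 * \<zeta>\<^sup>2"
  proof -
    have z: "\<eta> = 2 * \<zeta> + 1" using zeta by (simp add: field_simps)
    then have "3 * (- 1 - \<eta> / 3) = 2 * \<eta> * \<zeta>" "3 * (1 - \<eta> / 3) = 2 * \<eta> * \<zeta>\<^sup>2"
      using eta by (simp, algebra)+
    then show "- 1 - \<eta> / 3 = 2 * \<eta> / 3 * \<zeta>" "1 - \<eta> / 3 = 2 * \<eta> / 3 * \<zeta>\<^sup>2" by (simp_all add: field_simps)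
  qed
  ultimately have "pairing \<eta> c (R_vec \<eta> i {j, k}) = 2 * \<eta> / 3 * (c i + \<zeta> * (c j + c k) + \<zeta>\<^sup>2 * (c l + c m))"
    by (simp only:) (simp add: algebra_simps)
  then have "pairing \<eta> c (R_vec \<eta> i {j, k}) = 0 \<longleftrightarrow> c i + \<zeta> * (c j + c k) + \<zeta>\<^sup>2 * (c l + c m) = 0"
    using eta0 by (metis divide_eq_0_iff mult_eq_0_iff zero_neq_numeral)
  then show ?thesis using \<open>R_vec \<eta> i {j, k} \<in> L_space \<eta>\<close> by (simp add: hyp_def)
qed

lemma T_vec_in_hyp:
  assumes eta: "\<eta>\<^sup>2 = -3" and e: "enumerates i j k l m"
  shows "T_vec {i, j} \<in> hyp \<eta> c \<longleftrightarrow> c i = c j"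
proof -
  have "T_vec {i, j} \<in> L_space \<eta>"
    using T_vec_in_node_vectors[OF e] node_vectors_subset[OF eta] by blast
  moreover have "pairing \<eta> c (T_vec {i, j}) = (if i < j then c i - c j else c j - c i)"
    using enumeratesD[OF e] unfolding pairing_def sum_enumerates[OF e]
    by (auto simp: T_vec_def min_def max_def)
  ultimately show ?thesis by (auto simp: hyp_def)
qed

lemma E_vec_in_hyp:
  assumes eta: "\<eta>\<^sup>2 = -3" and p: "p \<in> {1..5}"
  shows "E_vec \<eta> p \<in> hyp \<eta> c \<longleftrightarrow> c p = 0"
proof -
  have "\<eta> \<noteq> 0" using eta by auto
  moreover have "E_vec \<eta> p \<in> L_space \<eta>"
    using node_vectors_subset[OF eta] p unfolding node_vectors_def by blast
  ultimately show ?thesis using pairing_E_vec[OF p] by (simp add: hyp_def)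
qed

text \<open>
  For a hyperplane with coefficients $v, w, x, y, z$, \<open>r_count\<close> counts the incident nodes
  $R_{A,B;c}$ whose index $c$ is that of the coefficient $v$; \<open>t_count\<close> and \<open>z_count\<close> count the
  incident nodes $T_C$ and $E_c$.
\<close>

definition r_count :: "complex \<Rightarrow> complex \<Rightarrow> complex \<Rightarrow> complex \<Rightarrow> complex \<Rightarrow> complex \<Rightarrow> nat" where
  "r_count \<zeta> v w x y z =
    of_bool (v + \<zeta> * (w + x) + \<zeta>\<^sup>2 * (y + z) = 0) + of_bool (v + \<zeta> * (w + y) + \<zeta>\<^sup>2 * (x + z) = 0) +
    of_bool (v + \<zeta> * (w + z) + \<zeta>\<^sup>2 * (x + y) = 0) + of_bool (v + \<zeta> * (x + y) + \<zeta>\<^sup>2 * (w + z) = 0) +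
    of_bool (v + \<zeta> * (x + z) + \<zeta>\<^sup>2 * (w + y) = 0) + of_bool (v + \<zeta> * (y + z) + \<zeta>\<^sup>2 * (w + x) = 0)"

definition t_count :: "complex \<Rightarrow> complex \<Rightarrow> complex \<Rightarrow> complex \<Rightarrow> complex \<Rightarrow> nat" where
  "t_count a b c d e =
    of_bool (a = b) + of_bool (a = c) + of_bool (a = d) + of_bool (a = e) + of_bool (b = c)
    + of_bool (b = d) + of_bool (b = e) + of_bool (c = d) + of_bool (c = e) + of_bool (d = e)"

definition z_count :: "complex \<Rightarrow> complex \<Rightarrow> complex \<Rightarrow> complex \<Rightarrow> complex \<Rightarrow> nat" where
  "z_count a b c d e =
    of_bool (a = 0) + of_bool (b = 0) + of_bool (c = 0) + of_bool (d = 0) + of_bool (e = 0)"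

lemma sum_pairs_of_4:
  fixes g :: "'a set \<Rightarrow> nat"
  assumes "distinct [j, k, l, m]"
  shows "sum g (subsets_of_card 2 {j, k, l, m}) =
    g {j, k} + g {j, l} + g {j, m} + g {k, l} + g {k, m} + g {l, m}"
  using assms
  by (simp add: numeral_2_eq_2 sum_subsets_insert sum_subsets_0 sum_subsets_empty)

lemma sum_pairs_of_5:
  fixes g :: "'a set \<Rightarrow> nat"
  assumes "distinct [i, j, k, l, m]"
  shows "sum g (subsets_of_card 2 {i, j, k, l, m}) =
    g {i, j} + g {i, k} + g {i, l} + g {i, m} + g {j, k} + g {j, l} + g {j, m} + g {k, l} + g {k, m} + g {l, m}"
  using assms
  by (simp add: numeral_2_eq_2 sum_subsets_insert sum_subsets_0 sum_subsets_empty)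

lemma sum_R_vec:
  assumes eta: "\<eta>\<^sup>2 = -3" and zeta: "\<zeta> = (-1 + \<eta>) / 2" and e: "enumerates i j k l m"
  shows "(\<Sum>A\<in>subsets_of_card 2 ({1..5} - {i}). of_bool (R_vec \<eta> i A \<in> hyp \<eta> c)) =
    r_count \<zeta> (c i) (c j) (c k) (c l) (c m)"
proof -
  have "enumerates i j l k m" "enumerates i j m k l" "enumerates i k l j m" "enumerates i k m j l" "enumerates i l m j k"
    using enumerates_swap e by meson+
  note this[THEN R_vec_in_hyp[OF eta zeta]] R_vec_in_hyp[OF eta zeta e]
  moreover have "distinct [j, k, l, m]" using enumeratesD(6)[OF e] by simp
  ultimately show ?thesis
    unfolding enumerates_Diff[OF e] by (subst sum_pairs_of_4) (simp_all add: r_count_def)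
qed

lemma sum_T_vec:
  assumes eta: "\<eta>\<^sup>2 = -3" and e: "enumerates i j k l m"
  shows "(\<Sum>C\<in>subsets_of_card 2 {1..5}. of_bool (T_vec C \<in> hyp \<eta> c)) =
    t_count (c i) (c j) (c k) (c l) (c m)"
proof -
  have "enumerates i k j l m" "enumerates i l j k m" "enumerates i m j k l" "enumerates j k i l m"
    "enumerates j l i k m" "enumerates j m i k l" "enumerates k l i j m" "enumerates k m i j l" "enumerates l m i j k"
    using enumerates_swap e by meson+
  note this[THEN T_vec_in_hyp[OF eta]] T_vec_in_hyp[OF eta e]
  then show ?thesis
    unfolding enumeratesD(7)[OF e] by (subst sum_pairs_of_5[OF enumeratesD(6)[OF e]]) (simp add: t_count_def)
qed

text \<open>The left side does not depend on the ordering, which is therefore free to be adapted to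
  the pattern of equal coefficients.\<close>

lemma card_nodes_hyp:
  assumes eta: "\<eta>\<^sup>2 = -3" and zeta: "\<zeta> = (-1 + \<eta>) / 2" and e: "enumerates i j k l m"
  shows "card {P \<in> nodes (L_space \<eta>) X_form. P \<subseteq> hyp \<eta> c} =
    (r_count \<zeta> (c i) (c j) (c k) (c l) (c m) + r_count \<zeta> (c j) (c i) (c k) (c l) (c m) +
     r_count \<zeta> (c k) (c i) (c j) (c l) (c m) + r_count \<zeta> (c l) (c i) (c j) (c k) (c m) +
     r_count \<zeta> (c m) (c i) (c j) (c k) (c l)) +
    t_count (c i) (c j) (c k) (c l) (c m) +
    z_count (c i) (c j) (c k) (c l) (c m)"
proof -
  have "enumerates j i k l m" "enumerates k i j l m" "enumerates l i j k m" "enumerates m i j k l"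
    using enumerates_swap e by meson+
  note this[THEN sum_R_vec[OF eta zeta]] sum_R_vec[OF eta zeta e]
  then have "(\<Sum>p\<in>{1..5}. \<Sum>A\<in>subsets_of_card 2 ({1..5} - {p}). of_bool (R_vec \<eta> p A \<in> hyp \<eta> c)) =
     r_count \<zeta> (c i) (c j) (c k) (c l) (c m) + r_count \<zeta> (c j) (c i) (c k) (c l) (c m) +
     r_count \<zeta> (c k) (c i) (c j) (c l) (c m) + r_count \<zeta> (c l) (c i) (c j) (c k) (c m) +
     r_count \<zeta> (c m) (c i) (c j) (c k) (c l)"
    unfolding sum_enumerates[OF e] by (simp only:)
  moreover have "(\<Sum>p\<in>{1..5}. of_bool (E_vec \<eta> p \<in> hyp \<eta> c)) =
      z_count (c i) (c j) (c k) (c l) (c m)"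
    using enumeratesD(7)[OF e] E_vec_in_hyp[OF eta] unfolding sum_enumerates[OF e] by (simp add: z_count_def)
  ultimately show ?thesis
    unfolding card_nodes_subset[OF eta subspace_hyp] card_node_vectors[OF eta] sum_T_vec[OF eta e] by simp
qed

section \<open>Coefficient patterns with eighteen nodes\<close>

lemma r_count_swap:
  "r_count \<zeta> v w x y z = r_count \<zeta> v x w y z"
  "r_count \<zeta> v w x y z = r_count \<zeta> v w y x z"
  "r_count \<zeta> v w x y z = r_count \<zeta> v w x z y"
  by (simp_all add: r_count_def add_ac)

text \<open>Here and in the next three lemmas equal coefficients merge the six conditions into fewer
  ones with multiplicities. The digits in the names are the sizes of the groups of equal
  coefficients among the last four arguments.\<close>

lemma r_count_4: "r_count \<zeta> v a a a a = 6 * of_bool (v + \<zeta> * (a + a) + \<zeta>\<^sup>2 * (a + a) = 0)"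
  by (simp add: r_count_def)

lemma r_count_31: "r_count \<zeta> v a a a d = 3 * of_bool (v + \<zeta> * (a + a) + \<zeta>\<^sup>2 * (a + d) = 0)
    + 3 * of_bool (v + \<zeta> * (a + d) + \<zeta>\<^sup>2 * (a + a) = 0)"
  by (simp add: r_count_def)

lemma r_count_22: "r_count \<zeta> v a a d d = of_bool (v + \<zeta> * (a + a) + \<zeta>\<^sup>2 * (d + d) = 0)
    + 4 * of_bool (v + \<zeta> * (a + d) + \<zeta>\<^sup>2 * (a + d) = 0) + of_bool (v + \<zeta> * (d + d) + \<zeta>\<^sup>2 * (a + a) = 0)"
  by (simp add: r_count_def)

lemma r_count_211: "r_count \<zeta> v a a b d = of_bool (v + \<zeta> * (a + a) + \<zeta>\<^sup>2 * (b + d) = 0)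
    + 2 * of_bool (v + \<zeta> * (a + b) + \<zeta>\<^sup>2 * (a + d) = 0) + 2 * of_bool (v + \<zeta> * (a + d) + \<zeta>\<^sup>2 * (a + b) = 0)
    + of_bool (v + \<zeta> * (b + d) + \<zeta>\<^sup>2 * (a + a) = 0)"
  by (simp add: r_count_def)

text \<open>
  For a fixed index $c$, all incident $R_{A,B;c}$ give the same sum of coefficients over $A$; hence
  \<open>r_count\<close> is bounded by the number of pairs with a prescribed sum.
\<close>

lemma pair_sum_unique:
  fixes \<zeta> :: complex
  assumes "\<zeta>\<^sup>2 \<noteq> \<zeta>" "v + \<zeta> * p + \<zeta>\<^sup>2 * q = 0" "v + \<zeta> * p' + \<zeta>\<^sup>2 * q' = 0" "p + q = p' + q'"
  shows "p = p'"
proof -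
  have "(\<zeta>\<^sup>2 - \<zeta>) * (p - p') = 0" using assms(2-4) by algebra
  then show ?thesis using assms(1) by simp
qed

definition pair_count :: "complex \<Rightarrow> complex \<Rightarrow> complex \<Rightarrow> complex \<Rightarrow> complex \<Rightarrow> nat" where
  "pair_count s w x y z = of_bool (w + x = s) + of_bool (w + y = s) + of_bool (w + z = s)
    + of_bool (x + y = s) + of_bool (x + z = s) + of_bool (y + z = s)"

text \<open>With q written as the total minus p, each condition is linear in p with leading
  coefficient \<zeta> - \<zeta>^2, so all six pair sums are compared with the same number.\<close>

lemma r_count_eq_pair_count:
  assumes "\<zeta>\<^sup>2 \<noteq> \<zeta>"
  shows "r_count \<zeta> v w x y z = pair_count ((v + \<zeta>\<^sup>2 * (w + x + y + z)) / (\<zeta>\<^sup>2 - \<zeta>)) w x y z"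
proof -
  have "v + \<zeta> * p + \<zeta>\<^sup>2 * q = 0 \<longleftrightarrow> p = (v + \<zeta>\<^sup>2 * (p + q)) / (\<zeta>\<^sup>2 - \<zeta>)" for p q
  proof -
    have "p = (v + \<zeta>\<^sup>2 * (p + q)) / (\<zeta>\<^sup>2 - \<zeta>) \<longleftrightarrow> p * (\<zeta>\<^sup>2 - \<zeta>) = v + \<zeta>\<^sup>2 * (p + q)"
      using assms by (simp add: eq_divide_eq)
    also have "\<dots> \<longleftrightarrow> v + \<zeta> * p + \<zeta>\<^sup>2 * q = 0" by algebra
    finally show ?thesis by simp
  qed
  then show ?thesis unfolding r_count_def pair_count_def by (simp add: add_ac)
qed

text \<open>Pairs that share an index have equal sums only if their other coefficients agree. With
  four different values only two complementary pairs can thus have the same sum; repeated values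
  contribute through their multiplicities.\<close>

lemma pair_count_le:
  shows "distinct [w, x, y, z] \<Longrightarrow> pair_count s w x y z \<le> 2"
    and "distinct [w, y, z] \<Longrightarrow> pair_count s w w y z \<le> 2"
    and "w \<noteq> y \<Longrightarrow> pair_count s w w y y \<le> 4"
    and "w \<noteq> z \<Longrightarrow> pair_count s w w w z \<le> 3"
  unfolding pair_count_def of_bool_def by auto

text \<open>
  The four disjuncts are the hyperplanes $F_i$, $G_i$, $K_{pq}$ and $S_{pq}$, in this order.
\<close>

definition steiner_pattern :: "complex \<Rightarrow> complex \<Rightarrow> complex \<Rightarrow> complex \<Rightarrow> complex \<Rightarrow> complex \<Rightarrow> bool" where
  "steiner_pattern \<zeta> a b c d e \<longleftrightarrow>
    a \<noteq> 0 \<and> b = a \<and> c = a \<and> d = a \<and> e = - \<zeta> * a \<or>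
    a \<noteq> 0 \<and> b = a \<and> c = a \<and> d = a \<and> e = - \<zeta>\<^sup>2 * a \<or>
    a \<noteq> 0 \<and> b = a \<and> c = a \<and> d = 0 \<and> e = 0 \<or>
    e \<noteq> 0 \<and> a = 0 \<and> b = 0 \<and> c = 0 \<and> d = - \<zeta> * e"

definition node_count :: "complex \<Rightarrow> complex \<Rightarrow> complex \<Rightarrow> complex \<Rightarrow> complex \<Rightarrow> complex \<Rightarrow> nat" where
  "node_count \<zeta> a b c d e = (r_count \<zeta> a b c d e + r_count \<zeta> b a c d e + r_count \<zeta> c a b d e
     + r_count \<zeta> d a b c e + r_count \<zeta> e a b c d) + t_count a b c d e + z_count a b c d e"

text \<open>Each pattern has twelve nodes R. The other six split between T and E as 6 + 0 for F_i
  and G_i, 4 + 2 for K_pq and 3 + 3 for S_pq.\<close>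

lemma steiner_pattern_node_count:
  assumes z: "\<zeta>\<^sup>2 + \<zeta> + 1 = 0" and p: "steiner_pattern \<zeta> a b c d e"
  shows "node_count \<zeta> a b c d e = 18"
proof -
  have ne: "\<zeta> \<noteq> 0" "\<zeta> \<noteq> 1" "\<zeta> \<noteq> -1" "\<zeta> \<noteq> -2" using z by (auto simp: power2_eq_square)
  have ne2: "\<zeta>\<^sup>2 \<noteq> 1" "\<zeta>\<^sup>2 \<noteq> \<zeta>" "1 + \<zeta> \<noteq> 0"
    using ne(2,3) power2_eq_1_iff[of \<zeta>] ne(1) by (auto simp: power2_eq_square add_eq_0_iff)
  have ne3: "\<zeta>\<^sup>2 + 2 \<noteq> 0" "\<zeta> + 2 \<noteq> 0" "2 * \<zeta> + 1 \<noteq> 0" "\<zeta> - 1 \<noteq> 0" "\<zeta>\<^sup>2 - \<zeta> \<noteq> 0"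
  proof -
    have "\<zeta>\<^sup>2 + 2 = 1 - \<zeta>" using z by algebra
    moreover have "1 - \<zeta> \<noteq> 0" using ne(2) by simp
    ultimately show "\<zeta>\<^sup>2 + 2 \<noteq> 0" by metis
    show "\<zeta> + 2 \<noteq> 0" using ne(4) by (simp add: add_eq_0_iff2)
    show "2 * \<zeta> + 1 \<noteq> 0"
    proof
      assume "2 * \<zeta> + 1 = 0"
      \<comment> \<open>4 (\<zeta>^2 + \<zeta> + 1) = (2\<zeta> + 1)^2 + 3.\<close>
      then have "(3::complex) = 0" using z by algebra
      then show False by simp
    qed
  qed (use ne2 ne in auto)
  from p consider "a \<noteq> 0" "b = a" "c = a" "d = a" "e = - \<zeta> * a" | "a \<noteq> 0" "b = a" "c = a" "d = a" "e = - \<zeta>\<^sup>2 * a"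
    | "a \<noteq> 0" "b = a" "c = a" "d = 0" "e = 0" | "e \<noteq> 0" "a = 0" "b = 0" "c = 0" "d = - \<zeta> * e"
    unfolding steiner_pattern_def by blast
  then show ?thesis
  proof cases
    case 1
    have x: "a + \<zeta> * (a + a) + \<zeta>\<^sup>2 * (a + e) = (\<zeta> - 1) * a" "a + \<zeta> * (a + e) + \<zeta>\<^sup>2 * (a + a) = 0"
      "e + \<zeta> * (a + a) + \<zeta>\<^sup>2 * (a + a) = - ((\<zeta> + 2) * a)" "a - e = (1 + \<zeta>) * a"
      using 1(5) z by algebra+
    have n: "(\<zeta> - 1) * a \<noteq> 0" "(\<zeta> + 2) * a \<noteq> 0" "(1 + \<zeta>) * a \<noteq> 0"
      using 1(1) ne3 ne2 by (simp_all only: mult_eq_0_iff) simp_all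
    have r: "r_count \<zeta> a a a a e = 3" "r_count \<zeta> e a a a a = 0"
      unfolding r_count_31 r_count_4 x using n by simp_all
    have "a \<noteq> e" using x(4) n(3) by (metis diff_self)
    moreover have "e \<noteq> 0" using 1 ne by simp
    ultimately show ?thesis
      unfolding node_count_def 1(2-4) r t_count_def z_count_def using 1(1) by simp
  next
    case 2
    have x: "a + \<zeta> * (a + e) + \<zeta>\<^sup>2 * (a + a) = (\<zeta>\<^sup>2 - 1) * a" "a + \<zeta> * (a + a) + \<zeta>\<^sup>2 * (a + e) = 0"
      "e + \<zeta> * (a + a) + \<zeta>\<^sup>2 * (a + a) = - ((\<zeta>\<^sup>2 + 2) * a)" "e - a = \<zeta> * a"
      using 2(5) z by algebra+
    have n: "(\<zeta>\<^sup>2 - 1) * a \<noteq> 0" "(\<zeta>\<^sup>2 + 2) * a \<noteq> 0" "\<zeta> * a \<noteq> 0"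
      using 2(1) ne3 ne2 ne by (simp_all only: mult_eq_0_iff) simp_all
    have r: "r_count \<zeta> a a a a e = 3" "r_count \<zeta> e a a a a = 0"
      unfolding r_count_31 r_count_4 x using n by simp_all
    have "a \<noteq> e" using x(4) n(3) by (metis diff_self)
    moreover have "e \<noteq> 0" using 2 ne by simp
    ultimately show ?thesis
      unfolding node_count_def 2(2-4) r t_count_def z_count_def using 2(1) by simp
  next
    case 3
    have x: "a + \<zeta> * (a + a) + \<zeta>\<^sup>2 * (0 + 0) = (2 * \<zeta> + 1) * a" "a + \<zeta> * (a + 0) + \<zeta>\<^sup>2 * (a + 0) = 0"
      "a + \<zeta> * (0 + 0) + \<zeta>\<^sup>2 * (a + a) = - ((2 * \<zeta> + 1) * a)"
      "0 + \<zeta> * (a + a) + \<zeta>\<^sup>2 * (a + 0) = (\<zeta> - 1) * a" "0 + \<zeta> * (a + 0) + \<zeta>\<^sup>2 * (a + a) = (\<zeta>\<^sup>2 - 1) * a"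
      using z by (algebra | simp add: algebra_simps | (simp add: algebra_simps; algebra))+
    have n: "(2 * \<zeta> + 1) * a \<noteq> 0" "(\<zeta> - 1) * a \<noteq> 0" "(\<zeta>\<^sup>2 - 1) * a \<noteq> 0"
      using 3(1) ne3 ne2 by (simp_all only: mult_eq_0_iff) simp_all
    have r: "r_count \<zeta> a a a 0 0 = 4" "r_count \<zeta> 0 a a a 0 = 0"
      unfolding r_count_31 r_count_22 x using n by simp_all
    then show ?thesis
      unfolding node_count_def 3(2-5) r t_count_def z_count_def using 3(1) by simp
  next
    case 4
    have x: "0 + \<zeta> * (0 + 0) + \<zeta>\<^sup>2 * (d + e) = (\<zeta>\<^sup>2 - 1) * e" "0 + \<zeta> * (0 + d) + \<zeta>\<^sup>2 * (0 + e) = 0"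
      "0 + \<zeta> * (0 + e) + \<zeta>\<^sup>2 * (0 + d) = (\<zeta> - 1) * e" "0 + \<zeta> * (d + e) + \<zeta>\<^sup>2 * (0 + 0) = - ((\<zeta>\<^sup>2 - \<zeta>) * e)"
      "d + \<zeta> * (0 + 0) + \<zeta>\<^sup>2 * (0 + e) = (\<zeta>\<^sup>2 - \<zeta>) * e" "d + \<zeta> * (0 + e) + \<zeta>\<^sup>2 * (0 + 0) = 0"
      "e + \<zeta> * (0 + 0) + \<zeta>\<^sup>2 * (0 + d) = 0" "e + \<zeta> * (0 + d) + \<zeta>\<^sup>2 * (0 + 0) = - ((\<zeta>\<^sup>2 - 1) * e)"
      "e - d = (1 + \<zeta>) * e"
      using 4(5) z by (algebra | simp add: algebra_simps | (simp add: algebra_simps; algebra))+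
    have n: "(\<zeta>\<^sup>2 - 1) * e \<noteq> 0" "(\<zeta> - 1) * e \<noteq> 0" "(\<zeta>\<^sup>2 - \<zeta>) * e \<noteq> 0" "(1 + \<zeta>) * e \<noteq> 0"
      using 4(1) ne3 ne2 by (simp_all only: mult_eq_0_iff) simp_all
    have r: "r_count \<zeta> 0 0 0 d e = 2" "r_count \<zeta> d 0 0 0 e = 3" "r_count \<zeta> e 0 0 0 d = 3"
      unfolding r_count_31 r_count_211 x using n by simp_all
    have "d \<noteq> e" using x(9) n(4) by (metis diff_self)
    moreover have "d \<noteq> 0" using 4 ne by simp
    ultimately show ?thesis
      unfolding node_count_def 4(2-4) r t_count_def z_count_def using 4(1) by simp
  qed
qed

text \<open>Only one of several different values can be 0, so the bounds are sizes of groups of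
  equal coefficients.\<close>

lemma z_count_le:
  "z_count a b c d e \<le> 5" "a \<noteq> d \<Longrightarrow> z_count a a a d d \<le> 3"
  "distinct [a, c, e] \<Longrightarrow> z_count a a c c e \<le> 2" "distinct [a, d, e] \<Longrightarrow> z_count a a a d e \<le> 3"
  "distinct [a, d, e] \<Longrightarrow> a \<noteq> 0 \<Longrightarrow> z_count a a a d e \<le> 1" "a \<noteq> e \<Longrightarrow> z_count a a a a e \<le> 4"
  by (auto simp: z_count_def of_bool_def)

text \<open>Counting R + T + E, the bounds are 10 + 0 + 5 for \<open>one\<close>, 10 + 1 + 5 for
  \<open>two\<close> and 12 + 2 + 2 for \<open>two_two\<close>, while \<open>five\<close> gives 0 +
  10 + 0. In \<open>three\<close>, \<open>three_two\<close> and \<open>four\<close> a count above 16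
  forces the equations of a Steiner pattern. \<open>N\<close> covers all orderings because
  \<open>pattern_cases\<close> chooses the ordering.\<close>

lemma node_count_pattern_cases:
  fixes c :: "6 \<Rightarrow> complex"
  assumes z: "\<zeta>\<^sup>2 + \<zeta> + 1 = 0" and p: "p \<in> {1..5}" "c p \<noteq> 0"
    and N: "\<And>i j k l m. enumerates i j k l m \<Longrightarrow> node_count \<zeta> (c i) (c j) (c k) (c l) (c m) = 18"
  obtains i j k l m where "enumerates i j k l m" "steiner_pattern \<zeta> (c i) (c j) (c k) (c l) (c m)"
proof -
  have "\<zeta> \<noteq> 0" "\<zeta> \<noteq> 1" using z by (auto simp: power2_eq_square)
  then have "\<zeta>\<^sup>2 \<noteq> \<zeta>" by (simp add: power2_eq_square)
  note R = r_count_eq_pair_count[OF this] and le = pair_count_le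
  have r4: "r_count \<zeta> v w x y z \<le> 2" if "distinct [w, x, y, z]" for v w x y z
    unfolding R using le(1)[OF that] .
  have r211: "r_count \<zeta> v w w y z \<le> 2" if "distinct [w, y, z]" for v w y z
    unfolding R using le(2)[OF that] .
  have r22: "r_count \<zeta> v w w y y \<le> 4" if "w \<noteq> y" for v w y
    unfolding R using le(3)[OF that] .
  have r31: "r_count \<zeta> v w w w y \<le> 3" if "w \<noteq> y" for v w y
    unfolding R using le(4)[OF that] .
  have r6: "r_count \<zeta> v w w w w \<le> 6" for v w
    unfolding r_count_4 by simp
  show thesis
  proof (cases rule: pattern_cases[of c])
    case (five i j k l m)
    let ?a = "c i"
    have "?a \<noteq> 0" using p five enumeratesD(7)[OF five(1)] by auto
    moreover have 1: "?a + \<zeta> * (?a + ?a) + \<zeta>\<^sup>2 * (?a + ?a) = - ?a" using z by algebra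
    ultimately have "node_count \<zeta> ?a ?a ?a ?a ?a = 10"
      unfolding node_count_def r_count_4 1 t_count_def z_count_def by simp
    then show thesis using N[OF five(1)] five by simp
  next
    case (four i j k l m)
    let ?a = "c i" and ?e = "c m"
    \<comment> \<open>Otherwise at most 6 nodes R, 6 nodes T and 4 nodes E would remain.\<close>
    have "r_count \<zeta> ?a ?a ?a ?a ?e \<noteq> 0"
    proof
      assume "r_count \<zeta> ?a ?a ?a ?a ?e = 0"
      moreover have "t_count ?a ?a ?a ?a ?e = 6" using four by (simp add: t_count_def)
      ultimately have "node_count \<zeta> ?a ?a ?a ?a ?e \<le> 16"
        unfolding node_count_def using r6[of ?e ?a] z_count_le(6)[of ?a ?e] four(5) by simp
      then show False using N[OF four(1)] four by simp
    qed
    then consider "?a + \<zeta> * (?a + ?a) + \<zeta>\<^sup>2 * (?a + ?e) = 0" | "?a + \<zeta> * (?a + ?e) + \<zeta>\<^sup>2 * (?a + ?a) = 0"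
      unfolding r_count_31 by auto
    then have e: "?e = - \<zeta> * ?a \<or> ?e = - \<zeta>\<^sup>2 * ?a"
    proof cases
      case 1
      then have "?e = - \<zeta>\<^sup>2 * ?a" using z by algebra
      then show ?thesis ..
    next
      case 2
      then have "?e = - \<zeta> * ?a" using z by algebra
      then show ?thesis ..
    qed
    then have "?a \<noteq> 0" using four by auto
    then show thesis using that[OF four(1)] four e unfolding steiner_pattern_def by simp
  next
    case (three_two i j k l m)
    let ?a = "c i" and ?d = "c l"
    have "?d = 0"
    proof (rule ccontr)
      assume d: "?d \<noteq> 0"
      \<comment> \<open>By \<zeta> + \<zeta>^2 = -1 the condition of multiplicity four would mean d
        = 0. The other two cannot hold together, since that would give 2a = 2d. So at most 3 + 6
        nodes R, 4 nodes T and 3 nodes E remain.\<close>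
      have "?a + \<zeta> * (?a + ?d) + \<zeta>\<^sup>2 * (?a + ?d) = - ?d" using z by algebra
      then have 4: "?a + \<zeta> * (?a + ?d) + \<zeta>\<^sup>2 * (?a + ?d) \<noteq> 0" using d by simp
      have "r_count \<zeta> ?a ?a ?a ?d ?d \<le> 1"
      proof (rule ccontr)
        assume "\<not> ?thesis"
        then have "?a + \<zeta> * (?a + ?a) + \<zeta>\<^sup>2 * (?d + ?d) = 0" "?a + \<zeta> * (?d + ?d) + \<zeta>\<^sup>2 * (?a + ?a) = 0"
          using 4 unfolding r_count_22 by (auto simp: of_bool_def split: if_splits)
        then have "?a + ?a = ?d + ?d" by (rule pair_sum_unique[OF \<open>\<zeta>\<^sup>2 \<noteq> \<zeta>\<close>]) (rule add.commute)
        then have "2 * ?a = 2 * ?d" by simp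
        then show False using three_two(4) by simp
      qed
      moreover have "t_count ?a ?a ?a ?d ?d = 4" using three_two by (simp add: t_count_def)
      ultimately have "node_count \<zeta> ?a ?a ?a ?d ?d \<le> 16"
        unfolding node_count_def using r31[of ?a ?d ?d] z_count_le(2)[of ?a ?d] three_two(4) by simp
      then show False using N[OF three_two(1)] three_two by simp
    qed
    then show thesis using that[OF three_two(1)] three_two unfolding steiner_pattern_def by simp
  next
    case (three i j k l m)
    let ?a = "c i" and ?d = "c l" and ?e = "c m"
    have t: "t_count ?a ?a ?a ?d ?e = 3" using three(4) by (auto simp: t_count_def)
    have r: "r_count \<zeta> ?a ?a ?a ?d ?e \<le> 2" "r_count \<zeta> ?d ?a ?a ?a ?e \<le> 3" "r_count \<zeta> ?e ?a ?a ?a ?d \<le> 3"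
      using three(4) by (auto intro!: r211 r31)
    have N18: "node_count \<zeta> ?a ?a ?a ?d ?e = 18" using N[OF three(1)] three(2,3) by simp
    \<comment> \<open>For a \<noteq> 0 at most one coefficient vanishes, and the total is at most 6
      + 3 + 3 nodes R, 3 nodes T and 1 node E.\<close>
    have a: "?a = 0"
    proof (rule ccontr)
      assume "?a \<noteq> 0"
      then show False
        using N18 z_count_le(5)[OF three(4)] t r unfolding node_count_def by linarith
    qed
    \<comment> \<open>Without such a node the bound is 6 + 3 nodes R, 3 nodes T and 3 nodes
      E.\<close>
    have "r_count \<zeta> ?d ?a ?a ?a ?e \<noteq> 0"
      using N18 z_count_le(4)[OF three(4)] t r unfolding node_count_def by linarith
    then consider "?d + \<zeta> * (?a + ?a) + \<zeta>\<^sup>2 * (?a + ?e) = 0" | "?d + \<zeta> * (?a + ?e) + \<zeta>\<^sup>2 * (?a + ?a) = 0"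
      unfolding r_count_31 by auto
    then show thesis
    proof cases
      \<comment> \<open>By \<zeta>^3 = 1 this solution is the pattern of S_pq with the last two
        indices exchanged.\<close>
      case 1
      then have "?e = - \<zeta> * ?d" using z a by algebra
      then have "steiner_pattern \<zeta> (c i) (c j) (c k) (c m) (c l)"
        using a three unfolding steiner_pattern_def by simp
      then show thesis using that[OF enumerates_swap(4)[OF three(1)]] by blast
    next
      case 2
      then have "?d = - \<zeta> * ?e" using a by algebra
      then have "steiner_pattern \<zeta> (c i) (c j) (c k) (c l) (c m)"
        using a three unfolding steiner_pattern_def by simp
      then show thesis using that[OF three(1)] by blast
    qed
  next
    case (two_two i j k l m)
    let ?a = "c i" and ?b = "c k" and ?e = "c m"
    have "t_count ?a ?a ?b ?b ?e = 2" using two_two(4) by (auto simp: t_count_def)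
    moreover have "r_count \<zeta> ?a ?a ?b ?b ?e \<le> 2" 
      using r211[of ?b ?a ?e ?a] two_two(4) r_count_swap by (metis distinct_length_2_or_more)
    moreover have "r_count \<zeta> ?b ?a ?a ?b ?e \<le> 2" using two_two(4) by (auto intro!: r211)
    moreover have "r_count \<zeta> ?e ?a ?a ?b ?b \<le> 4" using two_two(4) by (auto intro!: r22)
    ultimately have "node_count \<zeta> ?a ?a ?b ?b ?e \<le> 16"
      unfolding node_count_def using z_count_le(3)[OF two_two(4)] by linarith
    then show thesis using N[OF two_two(1)] two_two(2,3) by simp
  next
    case (two i j k l m)
    let ?a = "c i"
    have "t_count ?a ?a (c k) (c l) (c m) = 1" using two(3) by (auto simp: t_count_def)
    moreover have "r_count \<zeta> ?a ?a (c k) (c l) (c m) \<le> 2" using two(3) by (intro r4)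
    moreover have "r_count \<zeta> (c k) ?a ?a (c l) (c m) \<le> 2" "r_count \<zeta> (c l) ?a ?a (c k) (c m) \<le> 2"
      "r_count \<zeta> (c m) ?a ?a (c k) (c l) \<le> 2" using two(3) by (auto intro!: r211)
    ultimately have "node_count \<zeta> ?a ?a (c k) (c l) (c m) \<le> 16"
      unfolding node_count_def using z_count_le(1)[of ?a ?a "c k" "c l" "c m"] by linarith
    then show thesis using N[OF two(1)] two(2) by simp
  next
    case (one i j k l m)
    have "t_count (c i) (c j) (c k) (c l) (c m) = 0" using one(2) by (auto simp: t_count_def)
    moreover have "r_count \<zeta> (c i) (c j) (c k) (c l) (c m) \<le> 2" "r_count \<zeta> (c j) (c i) (c k) (c l) (c m) \<le> 2"
      "r_count \<zeta> (c k) (c i) (c j) (c l) (c m) \<le> 2" "r_count \<zeta> (c l) (c i) (c j) (c k) (c m) \<le> 2"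
      "r_count \<zeta> (c m) (c i) (c j) (c k) (c l) \<le> 2"
      using one(2) by (auto intro!: r4)
    ultimately have "node_count \<zeta> (c i) (c j) (c k) (c l) (c m) \<le> 15"
      unfolding node_count_def using z_count_le(1)[of "c i" "c j" "c k" "c l" "c m"] by linarith
    then show thesis using N[OF one(1)] by simp
  qed
qed

section \<open>The forty Steiner hyperplanes\<close>

text \<open>
  \<open>F_coeff \<zeta>\<close> and \<open>F_coeff (\<zeta>\<^sup>2)\<close> give the hyperplanes $F_i$ and $G_i$.
\<close>

definition F_coeff :: "complex \<Rightarrow> 6 \<Rightarrow> 6 \<Rightarrow> complex" where
  "F_coeff t i j = t + of_bool (j = i)"

text \<open>With this sign \<open>pairing\<close> is u_p + u_q itself on L_\<eta>: the three terms
  -(u_i - (\<eta>/3) a) outside \<open>C\<close> add up to \<eta> a minus the other coordinates. The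
  argument is a set because K_pq and K_qp coincide.\<close>

definition K_coeff :: "6 set \<Rightarrow> 6 \<Rightarrow> complex" where
  "K_coeff C j = of_bool (j \<in> C) - 1"

text \<open>In \<open>pairing\<close> the coefficient of a becomes (\<zeta>^2 - \<zeta>) \<eta>/3 =
  -\<eta>^2/3 = 1, which is exactly the form of S_pq.\<close>

definition S_coeff :: "complex \<Rightarrow> 6 \<Rightarrow> 6 \<Rightarrow> 6 \<Rightarrow> complex" where
  "S_coeff \<zeta> p q j = (if j = p then - \<zeta>\<^sup>2 else if j = q then \<zeta> else 0)"

lemma ex_enumerates_last:
  assumes "i \<in> {1..5}"
  obtains j k l m where "enumerates j k l m i"
proof -
  have "i \<in> {1, 2, 3, 4, 5}" using assms atLeastAtMost_1_5 by blast
  moreover have "enumerates 2 3 4 5 1" "enumerates 1 3 4 5 2" "enumerates 1 2 4 5 3" "enumerates 1 2 3 5 4" "enumerates 1 2 3 4 5"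
    by (intro enumeratesI; simp add: atLeastAtMost_1_5 insert_commute)+
  ultimately show thesis using that by blast
qed

lemma ex_enumerates_last2:
  assumes "p \<in> {1..5}" "q \<in> {1..5}" "p \<noteq> q"
  obtains j k l where "enumerates j k l p q"
proof -
  have "card {p, q} = 2" "{p, q} \<subseteq> {1..5}" using assms by auto
  then obtain j k l where "{1..5} - {p, q} = {j, k, l}"
    using complement_of_pair by metis
  then have "{j, k, l, p, q} = {1..5}" using assms by blast
  then show thesis using that enumeratesI by blast
qed

section \<open>The four families in coefficient form\<close>

context
  fixes \<eta> \<zeta> :: complex
  assumes eta: "\<eta>\<^sup>2 = -3" and zeta: "\<zeta> = (-1 + \<eta>) / 2"
begin

lemma eta_eq: "\<eta> = 2 * \<zeta> + 1"
  using zeta by (simp add: field_simps)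

lemma zeta_sq: "\<zeta>\<^sup>2 + \<zeta> + 1 = 0"
proof -
  have "4 * (\<zeta>\<^sup>2 + \<zeta> + 1) = 0" using eta unfolding eta_eq by algebra
  then show ?thesis by (metis mult_eq_0_iff zero_neq_numeral)
qed

lemma zeta_neq: "\<zeta> \<noteq> 0" "\<zeta> \<noteq> 1" "\<zeta> \<noteq> -1" "\<zeta>\<^sup>2 \<noteq> \<zeta>"
proof -
  show *: "\<zeta> \<noteq> 0" "\<zeta> \<noteq> 1" "\<zeta> \<noteq> -1" using zeta_sq by (auto simp: power2_eq_square)
  then show "\<zeta>\<^sup>2 \<noteq> \<zeta>" by (simp add: power2_eq_square)
qed

text \<open>On L_\<eta> the term \<zeta> (u_1 + ... + u_5) is \<zeta> \<eta> a, so a gets the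
  coefficient \<zeta> \<eta> - (5\<zeta> + 1) \<eta>/3 = -(2\<zeta> + 1) \<eta>/3 = 1. The factor 3
  in the proof clears denominators.\<close>

lemma F_hyp_eq:
  assumes "i \<in> {1..5}"
  shows "F_hyp \<eta> i = hyp \<eta> (F_coeff \<zeta> i)"
proof -
  obtain j k l m where e: "enumerates j k l m i" using ex_enumerates_last[OF assms] .
  have "3 * pairing \<eta> (F_coeff \<zeta> i) x = 3 * (x $ 0 + x $ i)" if "x \<in> L_space \<eta>" for x
  proof -
    have "x$j + x$k + x$l + x$m + x$i = \<eta> * x$0"
      using that unfolding L_space_def sum_enumerates[OF e] by simp
    moreover have "3 * pairing \<eta> (F_coeff \<zeta> i) x =
        \<zeta> * (3 * (x$j + x$k + x$l + x$m) - 4 * \<eta> * x$0) + (\<zeta> + 1) * (3 * x$i - \<eta> * x$0)"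
      using enumeratesD[OF e] unfolding pairing_def sum_enumerates[OF e]
      by (simp add: F_coeff_def algebra_simps)
    ultimately show ?thesis using eta_eq zeta_sq by algebra
  qed
  then have "pairing \<eta> (F_coeff \<zeta> i) x = x $ 0 + x $ i" if "x \<in> L_space \<eta>" for x
    using that by (metis mult_left_cancel zero_neq_numeral)
  then show ?thesis unfolding F_hyp_def hyp_def by auto
qed

text \<open>As for F_i, but 2\<zeta>^2 + 1 = -\<eta>, which reverses the sign of a.\<close>

lemma G_hyp_eq:
  assumes "i \<in> {1..5}"
  shows "G_hyp \<eta> i = hyp \<eta> (F_coeff (\<zeta>\<^sup>2) i)"
proof -
  obtain j k l m where e: "enumerates j k l m i" using ex_enumerates_last[OF assms] .
  have "3 * pairing \<eta> (F_coeff (\<zeta>\<^sup>2) i) x = 3 * (x $ i - x $ 0)" if "x \<in> L_space \<eta>" for x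
  proof -
    have "x$j + x$k + x$l + x$m + x$i = \<eta> * x$0"
      using that unfolding L_space_def sum_enumerates[OF e] by simp
    moreover have "3 * pairing \<eta> (F_coeff (\<zeta>\<^sup>2) i) x =
        \<zeta>\<^sup>2 * (3 * (x$j + x$k + x$l + x$m) - 4 * \<eta> * x$0) + (\<zeta>\<^sup>2 + 1) * (3 * x$i - \<eta> * x$0)"
      using enumeratesD[OF e] unfolding pairing_def sum_enumerates[OF e]
      by (simp add: F_coeff_def algebra_simps)
    ultimately show ?thesis using eta_eq zeta_sq by algebra
  qed
  then have "pairing \<eta> (F_coeff (\<zeta>\<^sup>2) i) x = x $ i - x $ 0" if "x \<in> L_space \<eta>" for x
    using that by (metis mult_left_cancel zero_neq_numeral)
  then show ?thesis unfolding G_hyp_def hyp_def by auto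
qed

lemma K_hyp_eq:
  assumes "p \<in> {1..5}" "q \<in> {1..5}" "p \<noteq> q"
  shows "K_hyp \<eta> p q = hyp \<eta> (K_coeff {p, q})"
proof -
  obtain j k l where e: "enumerates j k l p q" using ex_enumerates_last2[OF assms] .
  have "pairing \<eta> (K_coeff {p, q}) x = x $ p + x $ q" if "x \<in> L_space \<eta>" for x
  proof -
    have "x$j + x$k + x$l + x$p + x$q = \<eta> * x$0"
      using that unfolding L_space_def sum_enumerates[OF e] by simp
    moreover have "pairing \<eta> (K_coeff {p, q}) x = \<eta> * x$0 - (x$j + x$k + x$l)"
      using enumeratesD[OF e] unfolding pairing_def sum_enumerates[OF e]
      by (simp add: K_coeff_def algebra_simps)
    ultimately show ?thesis by algebra
  qed
  then show ?thesis unfolding K_hyp_def hyp_def by auto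
qed

lemma S_hyp_eq:
  assumes "p \<in> {1..5}" "q \<in> {1..5}" "p \<noteq> q"
  shows "S_hyp \<eta> \<zeta> p q = hyp \<eta> (S_coeff \<zeta> p q)"
proof -
  obtain j k l where e: "enumerates j k l p q" using ex_enumerates_last2[OF assms] .
  have "3 * pairing \<eta> (S_coeff \<zeta> p q) x = 3 * (x $ 0 - \<zeta>\<^sup>2 * x $ p + \<zeta> * x $ q)" for x
  proof -
    have "3 * pairing \<eta> (S_coeff \<zeta> p q) x = - \<zeta>\<^sup>2 * (3 * x$p - \<eta> * x$0) + \<zeta> * (3 * x$q - \<eta> * x$0)"
      using enumeratesD[OF e] unfolding pairing_def sum_enumerates[OF e]
      by (simp add: S_coeff_def algebra_simps)
    then show ?thesis using eta_eq zeta_sq by algebra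
  qed
  then have "pairing \<eta> (S_coeff \<zeta> p q) x = x $ 0 - \<zeta>\<^sup>2 * x $ p + \<zeta> * x $ q" for x
    by (metis mult_left_cancel zero_neq_numeral)
  then show ?thesis unfolding S_hyp_def hyp_def by auto
qed

lemma card_nodes_hyp_node_count:
  assumes "enumerates i j k l m"
  shows "card {P \<in> nodes (L_space \<eta>) X_form. P \<subseteq> hyp \<eta> c} = node_count \<zeta> (c i) (c j) (c k) (c l) (c m)"
  unfolding card_nodes_hyp[OF eta zeta assms] node_count_def ..

lemma steiner_hyperplane_hyp:
  assumes e: "enumerates i j k l m" and p: "steiner_pattern \<zeta> (c i) (c j) (c k) (c l) (c m)"
  shows "steiner_hyperplane (L_space \<eta>) X_form (hyp \<eta> c)"
proof -
  have "c i \<noteq> 0 \<or> c m \<noteq> 0" using p unfolding steiner_pattern_def by blast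
  then obtain n where "n \<in> {1..5}" "c n \<noteq> 0" using enumeratesD(7)[OF e] by blast
  then show ?thesis
    unfolding steiner_hyperplane_def card_nodes_hyp_node_count[OF e]
    using hyperplane_of_hyp[OF eta] steiner_pattern_node_count[OF zeta_sq p] by blast
qed

lemma steiner_hyperplanes_eq:
  "{H. steiner_hyperplane (L_space \<eta>) X_form H} =
     (\<lambda>i. hyp \<eta> (F_coeff \<zeta> i)) ` {1..5} \<union> (\<lambda>i. hyp \<eta> (F_coeff (\<zeta>\<^sup>2) i)) ` {1..5} \<union>
     (\<lambda>C. hyp \<eta> (K_coeff C)) ` subsets_of_card 2 {1..5} \<union>
     (\<lambda>(p, q). hyp \<eta> (S_coeff \<zeta> p q)) ` {(p, q). p \<in> {1..5} \<and> q \<in> {1..5} \<and> p \<noteq> q}" (is "?L = ?R")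
proof
  show "?L \<subseteq> ?R"
  proof
    fix H assume "H \<in> ?L"
    then have hyp: "hyperplane_of (L_space \<eta>) H" and card: "card {P \<in> nodes (L_space \<eta>) X_form. P \<subseteq> H} = 18"
      by (auto simp: steiner_hyperplane_def)
    obtain c p where H: "H = hyp \<eta> c" "p \<in> {1..5}" "c p \<noteq> 0"
      using hyperplane_imp_hyp[OF eta hyp] .
    have "node_count \<zeta> (c i) (c j) (c k) (c l) (c m) = 18" if "enumerates i j k l m" for i j k l m
      using card unfolding H(1) card_nodes_hyp_node_count[OF that] .
    then obtain i j k l m where e: "enumerates i j k l m" and pat: "steiner_pattern \<zeta> (c i) (c j) (c k) (c l) (c m)"
      using node_count_pattern_cases[OF zeta_sq, of p c] H(2,3) by metis
    note D = enumeratesD[OF e]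
    have scale: "hyp \<eta> c = hyp \<eta> d" if "t \<noteq> 0" "c i = t * d i" "c j = t * d j" "c k = t * d k" "c l = t * d l" "c m = t * d m" for t d
      using hyp_scale[OF that(1), of c d] that(2-6) D(7) by auto
    from pat consider "c i \<noteq> 0" "c j = c i" "c k = c i" "c l = c i" "c m = - \<zeta> * c i"
      | "c i \<noteq> 0" "c j = c i" "c k = c i" "c l = c i" "c m = - \<zeta>\<^sup>2 * c i"
      | "c i \<noteq> 0" "c j = c i" "c k = c i" "c l = 0" "c m = 0"
      | "c m \<noteq> 0" "c i = 0" "c j = 0" "c k = 0" "c l = - \<zeta> * c m"
      unfolding steiner_pattern_def by blast
    then show "H \<in> ?R"
    proof cases
      case 1
      have "H = hyp \<eta> (F_coeff \<zeta> m)"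
      proof (unfold H(1), rule scale)
        \<comment> \<open>The pattern (a, a, a, a, -\<zeta> a) is a/\<zeta> times (\<zeta>, \<zeta>,
          \<zeta>, \<zeta>, -\<zeta>^2), and -\<zeta>^2 = \<zeta> + 1.\<close>
        show "c i / \<zeta> \<noteq> 0" using 1 zeta_neq by simp
        have "- \<zeta> * \<zeta> = \<zeta> + 1" using zeta_sq by algebra
        then have "c m = c i / \<zeta> * (\<zeta> + 1)"
          using 1(5) zeta_neq(1) by (simp add: eq_divide_eq) algebra
        then show "c m = c i / \<zeta> * F_coeff \<zeta> m m" by (simp add: F_coeff_def)
      qed (use 1 D zeta_neq in \<open>simp_all add: F_coeff_def\<close>)
      then show ?thesis using D by blast
    next
      case 2
      have "H = hyp \<eta> (F_coeff (\<zeta>\<^sup>2) m)"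
      proof (unfold H(1), rule scale)
        show "c i / \<zeta>\<^sup>2 \<noteq> 0" using 2 zeta_neq by simp
        have "- \<zeta>\<^sup>2 * \<zeta>\<^sup>2 = \<zeta>\<^sup>2 + 1" using zeta_sq by algebra
        then have "c m = c i / \<zeta>\<^sup>2 * (\<zeta>\<^sup>2 + 1)"
          using 2(5) zeta_neq(1) by (simp add: eq_divide_eq) algebra
        then show "c m = c i / \<zeta>\<^sup>2 * F_coeff (\<zeta>\<^sup>2) m m" by (simp add: F_coeff_def)
      qed (use 2 D zeta_neq in \<open>simp_all add: F_coeff_def\<close>)
      then show ?thesis using D by blast
    next
      case 3
      have "H = hyp \<eta> (K_coeff {l, m})"
        unfolding H(1) by (rule scale[of "- c i"]) (use 3 D in \<open>simp_all add: K_coeff_def\<close>)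
      moreover have "{l, m} \<in> subsets_of_card 2 {1..5}"
        using D by (auto simp: subsets_of_card_def)
      ultimately show ?thesis by blast
    next
      case 4
      have "H = hyp \<eta> (S_coeff \<zeta> l m)"
        unfolding H(1) by (rule scale[of "c m / \<zeta>"])
          (use 4 D zeta_neq in \<open>simp_all add: S_coeff_def power2_eq_square\<close>)
      moreover have "l \<in> {1..5}" "m \<in> {1..5}" "l \<noteq> m" using D by auto
      ultimately show ?thesis by blast
    qed
  qed
next
  have F: "steiner_hyperplane (L_space \<eta>) X_form (hyp \<eta> (F_coeff \<zeta> i))" if "i \<in> {1..5}" for i
  proof -
    obtain j k l m where e: "enumerates j k l m i" using ex_enumerates_last[OF \<open>i \<in> {1..5}\<close>] .
    have "\<zeta> + 1 = - \<zeta> * \<zeta>" using zeta_sq by algebra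
    then show ?thesis using enumeratesD[OF e] zeta_neq
      by (intro steiner_hyperplane_hyp[OF e]) (simp add: steiner_pattern_def F_coeff_def)
  qed
  have G: "steiner_hyperplane (L_space \<eta>) X_form (hyp \<eta> (F_coeff (\<zeta>\<^sup>2) i))" if "i \<in> {1..5}" for i
  proof -
    obtain j k l m where e: "enumerates j k l m i" using ex_enumerates_last[OF \<open>i \<in> {1..5}\<close>] .
    have "\<zeta>\<^sup>2 + 1 = - \<zeta>\<^sup>2 * \<zeta>\<^sup>2" using zeta_sq by algebra
    then show ?thesis using enumeratesD[OF e] zeta_neq
      by (intro steiner_hyperplane_hyp[OF e]) (simp add: steiner_pattern_def F_coeff_def)
  qed
  have K: "steiner_hyperplane (L_space \<eta>) X_form (hyp \<eta> (K_coeff C))" if "C \<in> subsets_of_card 2 {1..5}" for C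
  proof -
    obtain p q where pq: "C = {p, q}" "p \<noteq> q" "p \<in> {1..5}" "q \<in> {1..5}"
      using \<open>C \<in> subsets_of_card 2 {1..5}\<close> by (auto simp: subsets_of_card_def card_2_iff)
    obtain j k l where e: "enumerates j k l p q" using ex_enumerates_last2[OF pq(3,4,2)] .
    show ?thesis using enumeratesD[OF e] unfolding pq(1)
      by (intro steiner_hyperplane_hyp[OF e]) (simp add: steiner_pattern_def K_coeff_def)
  qed
  have S: "steiner_hyperplane (L_space \<eta>) X_form (hyp \<eta> (S_coeff \<zeta> p q))"
    if "p \<in> {1..5}" "q \<in> {1..5}" "p \<noteq> q" for p q
  proof -
    obtain j k l where e: "enumerates j k l p q" using ex_enumerates_last2 \<open>p \<in> {1..5}\<close> \<open>q \<in> {1..5}\<close> \<open>p \<noteq> q\<close> by metis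
    show ?thesis using enumeratesD[OF e] zeta_neq
      by (intro steiner_hyperplane_hyp[OF e]) (simp add: steiner_pattern_def S_coeff_def power2_eq_square)
  qed
  show "?R \<subseteq> ?L"
    by (intro Un_least image_subsetI) (use F G K S in auto)
qed

text \<open>Proportionality at the indices i and j gives (t + 1)^2 = t^2, that is 2t + 1 = 0; but 2t
  + 1 is \<eta> for t = \<zeta> and -\<eta> for t = \<zeta>^2.\<close>

lemma inj_on_F: "t \<in> {\<zeta>, \<zeta>\<^sup>2} \<Longrightarrow> inj_on (\<lambda>i. hyp \<eta> (F_coeff t i)) {1..5}"
proof (rule inj_onI, rule ccontr)
  fix i j :: 6 assume t: "t \<in> {\<zeta>, \<zeta>\<^sup>2}" and ij: "i \<in> {1..5}" "j \<in> {1..5}" "i \<noteq> j"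
    and "hyp \<eta> (F_coeff t i) = hyp \<eta> (F_coeff t j)"
  from hyp_eq_imp_proportional[OF eta this(5) ij(1,2)] have "(t + 1) * (t + 1) = t * t"
    using ij by (simp add: F_coeff_def)
  then have "2 * t + 1 = 0" by algebra
  moreover have "t = \<zeta> \<or> t = - \<zeta> - 1" using t zeta_sq by (auto simp: algebra_simps) algebra
  ultimately have "2 * \<zeta> + 1 = 0" by auto algebra
  then show False using eta_eq eta by simp
qed

text \<open>The number of nodes E_p on the hyperplane is 0 for F_i and G_i, 2 for K_pq and 3 for
  S_pq, which separates all families except F from G. The set \<open>?Z H\<close> of their indices
  also recovers {p, q} within K and S. The minors of \<open>hyp_eq_imp_proportional\<close> tell F
  from G and S_pq from S_qp.\<close>

lemma card_steiner: "card {H. steiner_hyperplane (L_space \<eta>) X_form H} = 40"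
proof -
  let ?F = "(\<lambda>i. hyp \<eta> (F_coeff \<zeta> i)) ` {1..5}" and ?G = "(\<lambda>i. hyp \<eta> (F_coeff (\<zeta>\<^sup>2) i)) ` {1..5}"
  let ?K = "(\<lambda>C. hyp \<eta> (K_coeff C)) ` subsets_of_card 2 {1..5}"
  let ?I = "{(p, q). p \<in> {1..5::6} \<and> q \<in> {1..5::6} \<and> p \<noteq> q}"
  let ?S = "(\<lambda>(p, q). hyp \<eta> (S_coeff \<zeta> p q)) ` ?I"
  let ?Z = "\<lambda>H. {p \<in> {1..5}. E_vec \<eta> p \<in> H}"
  have Z: "?Z (hyp \<eta> c) = {p \<in> {1..5}. c p = 0}" for c
    using E_vec_in_hyp[OF eta] by blast
  have zF: "?Z (hyp \<eta> (F_coeff t i)) = {}" if "t = \<zeta> \<or> t = \<zeta>\<^sup>2" for t i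
  proof -
    have "\<zeta> + 1 \<noteq> 0" "\<zeta>\<^sup>2 + 1 \<noteq> 0"
      using zeta_neq zeta_sq by (auto simp: add_eq_0_iff2 add_eq_0_iff algebra_simps)
    then show ?thesis unfolding Z using that zeta_neq(1) by (auto simp: F_coeff_def)
  qed
  have zK: "?Z (hyp \<eta> (K_coeff C)) = C" if "C \<in> subsets_of_card 2 {1..5}" for C
    using that unfolding Z by (auto simp: K_coeff_def subsets_of_card_def)
  have zS: "?Z (hyp \<eta> (S_coeff \<zeta> p q)) = {1..5} - {p, q}" for p q
    unfolding Z using zeta_neq(1) by (auto simp: S_coeff_def)
  have cF: "card (?Z H) = 0" if "H \<in> ?F \<union> ?G" for H using that zF by auto
  have cK: "card (?Z H) = 2" if "H \<in> ?K" for H 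
    using that zK by (auto simp: subsets_of_card_def)
  have cS: "card (?Z H) = 3" if H: "H \<in> ?S" for H
  proof -
    obtain p q where pq: "H = hyp \<eta> (S_coeff \<zeta> p q)" "p \<in> {1..5}" "q \<in> {1..5}" "p \<noteq> q"
      using H by (auto simp del: atLeastAtMost_iff)
    have "card ({1..5} - {p, q}) = card {1..5::6} - card {p, q}"
      by (rule card_Diff_subset) (use pq in auto)
    then show ?thesis unfolding pq(1) zS using pq(4) by (simp add: card_5)
  qed
  have "card (?Z H) \<noteq> 3" if "H \<in> ?F \<union> ?G \<union> ?K" for H
    using that
  proof (rule UnE)
    assume "H \<in> ?F \<union> ?G"
    from cF[OF this] show ?thesis by linarith
  next
    assume "H \<in> ?K"
    from cK[OF this] show ?thesis by linarith
  qed
  note not3 = this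
  have disjI: "A \<inter> B = {}" if "\<And>H. H \<in> A \<Longrightarrow> card (?Z H) \<noteq> n" "\<And>H. H \<in> B \<Longrightarrow> card (?Z H) = n" for A B n
    using that by blast
  have disj1: "(?F \<union> ?G) \<inter> ?K = {}"
  proof (rule disjI)
    show "card (?Z H) \<noteq> 2" if "H \<in> ?F \<union> ?G" for H using cF[OF that] by linarith
  qed (rule cK)
  have disj2: "(?F \<union> ?G \<union> ?K) \<inter> ?S = {}"
    by (rule disjI[of _ 3]) (rule not3, assumption, rule cS)
  have FG: "?F \<inter> ?G = {}"
  proof (intro equals0I, elim IntE imageE)
    fix H i j assume *: "H = hyp \<eta> (F_coeff \<zeta> i)" "i \<in> {1..5}" "H = hyp \<eta> (F_coeff (\<zeta>\<^sup>2) j)" "j \<in> {1..5}"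
    then have ij: "i \<in> {1..5}" "j \<in> {1..5}" "hyp \<eta> (F_coeff \<zeta> i) = hyp \<eta> (F_coeff (\<zeta>\<^sup>2) j)"
      by simp_all
    \<comment> \<open>In either case the minor for i and an index k outside {i, j} is used; its
      vanishing means \<zeta>^2 = \<zeta> if i = j, and \<zeta>^2 = 0 otherwise.\<close>
    show False
    proof (cases "i = j")
      case True
      obtain k l m n where e: "enumerates k l m n i" using ex_enumerates_last[OF ij(1)] .
      then have k: "k \<in> {1..5}" "k \<noteq> i" using enumeratesD[OF e] by auto
      have "(\<zeta> + 1) * \<zeta>\<^sup>2 = \<zeta> * (\<zeta>\<^sup>2 + 1)"
        using hyp_eq_imp_proportional[OF eta ij(3) ij(1) k(1)] k(2) True by (simp add: F_coeff_def)
      then have "\<zeta>\<^sup>2 = \<zeta>" by algebra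
      then show False using zeta_neq by simp
    next
      case False
      obtain k l m where e: "enumerates k l m i j" using ex_enumerates_last2[OF ij(1,2) False] .
      then have k: "k \<in> {1..5}" "k \<noteq> i" "k \<noteq> j" using enumeratesD[OF e] by auto
      have "(\<zeta> + 1) * \<zeta>\<^sup>2 = \<zeta> * \<zeta>\<^sup>2"
        using hyp_eq_imp_proportional[OF eta ij(3) ij(1) k(1)] k False by (simp add: F_coeff_def)
      then have "\<zeta>\<^sup>2 = 0" by algebra
      then show False using zeta_neq by simp
    qed
  qed
  have injK: "inj_on (\<lambda>C. hyp \<eta> (K_coeff C)) (subsets_of_card 2 {1..5})"
  proof (rule inj_onI)
    fix C D :: "6 set"
    assume "C \<in> subsets_of_card 2 {1..5}" "D \<in> subsets_of_card 2 {1..5}" and eq: "hyp \<eta> (K_coeff C) = hyp \<eta> (K_coeff D)"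
    from zK[OF this(1)] zK[OF this(2)] show "C = D" unfolding eq by simp
  qed
  have injS: "inj_on (\<lambda>(p, q). hyp \<eta> (S_coeff \<zeta> p q)) ?I"
  proof (rule inj_onI, clarify)
    fix p q p' q' :: 6
    assume *: "p \<in> {1..5}" "q \<in> {1..5}" "p \<noteq> q" "p' \<in> {1..5}" "q' \<in> {1..5}" "p' \<noteq> q'"
      and eq: "hyp \<eta> (S_coeff \<zeta> p q) = hyp \<eta> (S_coeff \<zeta> p' q')"
    have "{1..5} - {p, q} = {1..5} - {p', q'}" using zS[of p q] zS[of p' q'] eq by simp
    then have "{p, q} = {p', q'}" using * by blast
    moreover have "\<not> (p' = q \<and> q' = p)"
    proof
      assume "p' = q \<and> q' = p"
      \<comment> \<open>This is the minor for p and q; its left side \<zeta>^4 equals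
        \<zeta>.\<close>
      then have "\<zeta>\<^sup>2 * \<zeta>\<^sup>2 = \<zeta> * \<zeta>"
        using hyp_eq_imp_proportional[OF eta eq *(1,2)] *(3) by (simp add: S_coeff_def)
      then have "\<zeta>\<^sup>2 = \<zeta>" using zeta_sq by algebra
      then show False using zeta_neq by simp
    qed
    ultimately show "p = p' \<and> q = q'" by (auto simp: doubleton_eq_iff)
  qed
  have cardK: "card (subsets_of_card 2 {1..5::6}) = 10"
    unfolding subsets_of_card_def by (simp add: n_subsets card_5 choose_two)
  have "?I = {1..5} \<times> {1..5} - (\<lambda>p. (p, p)) ` {1..5}" by auto
  moreover have "card ({1..5::6} \<times> {1..5::6} - (\<lambda>p. (p, p)) ` {1..5}) = 20"
    by (subst card_Diff_subset) (auto simp: card_image inj_on_def card_5 card_cartesian_product simp del: atLeastAtMost_iff)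
  ultimately have cardI: "card ?I = 20" by simp
  have fin: "finite ?F" "finite ?G" "finite ?K" "finite ?S"
    using cardI by (auto intro!: finite_subsets_of_card simp: card_ge_0_finite simp del: atLeastAtMost_iff)
  have "card (?F \<union> ?G \<union> ?K \<union> ?S) = card ?F + card ?G + card ?K + card ?S"
    using fin disj1 disj2 FG by (simp only: card_Un_disjoint finite_UnI)
  also have "\<dots> = 5 + 5 + 10 + 20"
    unfolding card_image[OF inj_on_F[of \<zeta>, simplified]] card_image[OF inj_on_F[of "\<zeta>\<^sup>2", simplified]] card_image[OF injK] card_image[OF injS] 
    using card_5 cardK cardI by simp
  finally show ?thesis unfolding steiner_hyperplanes_eq by simp
qed

end

theorem corollary7p4:
  fixes \<eta> \<zeta> :: complex
  assumes "\<eta>\<^sup>2 = -3" and "\<zeta> = (-1 + \<eta>) / 2"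
  shows "{H. steiner_hyperplane (L_space \<eta>) X_form H} =
           {F_hyp \<eta> i | i. i \<in> {1..5}} \<union> {G_hyp \<eta> i | i. i \<in> {1..5}} \<union>
           {K_hyp \<eta> p q | p q. p \<in> {1..5} \<and> q \<in> {1..5} \<and> p < q} \<union>
           {S_hyp \<eta> \<zeta> p q | p q. p \<in> {1..5} \<and> q \<in> {1..5} \<and> p \<noteq> q}
         \<and> card {H. steiner_hyperplane (L_space \<eta>) X_form H} = 40"
proof
  have F: "{F_hyp \<eta> i | i. i \<in> {1..5}} = (\<lambda>i. hyp \<eta> (F_coeff \<zeta> i)) ` {1..5}"
    using F_hyp_eq[OF assms] by blast
  have G: "{G_hyp \<eta> i | i. i \<in> {1..5}} = (\<lambda>i. hyp \<eta> (F_coeff (\<zeta>\<^sup>2) i)) ` {1..5}"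
    using G_hyp_eq[OF assms] by blast
  have S: "{S_hyp \<eta> \<zeta> p q | p q. p \<in> {1..5} \<and> q \<in> {1..5} \<and> p \<noteq> q} =
      (\<lambda>(p, q). hyp \<eta> (S_coeff \<zeta> p q)) ` {(p, q). p \<in> {1..5} \<and> q \<in> {1..5} \<and> p \<noteq> q}"
    using S_hyp_eq[OF assms] by fastforce
  \<comment> \<open>Each two-element set of indices has exactly one increasing listing, which
    matches the condition p < q with \<open>subsets_of_card 2\<close>.\<close>
  have K: "{K_hyp \<eta> p q | p q. p \<in> {1..5} \<and> q \<in> {1..5} \<and> p < q} = (\<lambda>C. hyp \<eta> (K_coeff C)) ` subsets_of_card 2 {1..5}"
    (is "?L = ?R")
  proof
    show "?L \<subseteq> ?R"
    proof
      fix H assume "H \<in> ?L"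
      then obtain p q where pq: "H = K_hyp \<eta> p q" "p \<in> {1..5}" "q \<in> {1..5}" "p < q" by blast
      then have "{p, q} \<in> subsets_of_card 2 {1..5}" by (auto simp: subsets_of_card_def)
      then show "H \<in> ?R" using K_hyp_eq[OF assms pq(2,3)] pq(1,4) by blast
    qed
    show "?R \<subseteq> ?L"
    proof
      fix H assume "H \<in> ?R"
      then obtain C where C: "H = hyp \<eta> (K_coeff C)" "C \<subseteq> {1..5}" "card C = 2"
        by (auto simp: subsets_of_card_def)
      then obtain p q where pq: "C = {p, q}" "p \<noteq> q" by (auto simp: card_2_iff)
      then obtain p' q' where "C = {p', q'}" "p' < q'"
        by (metis insert_commute linorder_neq_iff)
      moreover from this have "p' \<in> {1..5}" "q' \<in> {1..5}" using C(2) by auto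
      ultimately show "H \<in> ?L"
        using K_hyp_eq[OF assms, of p' q'] C(1) by blast
    qed
  qed
  show "{H. steiner_hyperplane (L_space \<eta>) X_form H} =
           {F_hyp \<eta> i | i. i \<in> {1..5}} \<union> {G_hyp \<eta> i | i. i \<in> {1..5}} \<union>
           {K_hyp \<eta> p q | p q. p \<in> {1..5} \<and> q \<in> {1..5} \<and> p < q} \<union>
           {S_hyp \<eta> \<zeta> p q | p q. p \<in> {1..5} \<and> q \<in> {1..5} \<and> p \<noteq> q}"
    unfolding F G K S by (rule steiner_hyperplanes_eq[OF assms])
  show "card {H. steiner_hyperplane (L_space \<eta>) X_form H} = 40"
    by (rule card_steiner[OF assms])
qed

end
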